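(* Let $\alpha > 1$ be a real number. There exists a constant $N_0$ such that for every $n \ge N_0$, every $K_3$-free graph $G$ on $n$ vertices satisfies $$\lambda_{\alpha, C_5}(G) \le \max\left\{ \lambda_{\alpha, C_5}(H) : H \in \mathfrak{C}_5 \text{ and } v(H) = n\right\},$$ with equality only if $G \in \mathfrak{C}_5$.
   Context: Graphs are finite and simple; $v(G)$ is the number of vertices of $G$. A graph is $K_3$-free if it contains no triangle as a (not necessarily induced) subgraph. $C_5$ is the cycle on vertex set $\{1,2,3,4,5\}$ with edges $\{1,2\},\{2,3\},\{3,4\},\{4,5\},\{5,1\}$. A homomorphism from $G$ to $H$ is a map $\phi: V(G)\to V(H)$ sending every edge of $G$ to an edge of $H$. A graph $G$ is $C_5$-colorable if there is a homomorphism from $G$ to $C_5$. $\mathfrak{C}_5$ denotes the collection of all $C_5$-colorable graphs. For a graph $G$ on vertex set $[n]=\{1,\dots,n\}$, let $\mathrm{Inj}(C_5,G)$ be the set of all injective homomorphisms from $C_5$ to $G$, and let $$P_{C_5,G}(X_1,\ldots,X_n) := \sum_{\phi\in \mathrm{Inj}(C_5,G)} \ \prod_{i\in \phi(V(C_5))} X_i .$$ Let $\Delta^{n-1}_{\alpha} := \{(x_1,\ldots,x_n)\in\mathbb{R}^n : |x_1|^{\alpha}+\cdots+|x_n|^{\alpha}=1\}$. The $(\alpha,C_5)$-spectral radius of $G$ is $$\lambda_{\alpha,C_5}(G) := \max\{P_{C_5,G}(x_1,\ldots,x_n) : (x_1,\ldots,x_n)\in\Delta^{n-1}_{\alpha}\}.$$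 (For a graph on another $n$-element vertex set, identify the vertex set with $[n]$; the value does not depend on the identification.) *)

theory Defs
  imports "HOL-Analysis.Analysis" "Graph_Theory.Graph_Theory"
begin

text \<open>
  Finite simple graphs are the loop-free symmetric finite digraphs without parallel arcs
  of \<^locale>\<open>pair_graph\<close>; an edge \<open>{u,v}\<close> is the pair of arcs \<open>(u,v)\<close>, \<open>(v,u)\<close>.
\<close>

definition K3_free :: "'a pair_pre_digraph \<Rightarrow> bool" where
  "K3_free G \<longleftrightarrow> \<not> (\<exists>H :: 'a pair_pre_digraph. subgraph H G \<and> K\<^bsub>3\<^esub> H)"

text \<open>
  Homomorphisms are taken extensional (undefined off the vertex set of the source), so that
  each map between the vertex sets is represented once when summing over homomorphisms.
\<close>

definition graph_homs :: "'a pair_pre_digraph \<Rightarrow> 'b pair_pre_digraph \<Rightarrow> ('a \<Rightarrow> 'b) set" where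
  "graph_homs F G =
     {\<phi> \<in> pverts F \<rightarrow>\<^sub>E pverts G. \<forall>(u, v) \<in> parcs F. (\<phi> u, \<phi> v) \<in> parcs G}"

definition inj_homs :: "'a pair_pre_digraph \<Rightarrow> 'b pair_pre_digraph \<Rightarrow> ('a \<Rightarrow> 'b) set" where
  "inj_homs F G = {\<phi> \<in> graph_homs F G. inj_on \<phi> (pverts F)}"

definition C5 :: "nat pair_pre_digraph" where
  "C5 = (let E = {(1,2), (2,3), (3,4), (4,5), (5,1)}
         in \<lparr> pverts = {1..5}, parcs = E \<union> E\<inverse> \<rparr>)"

definition C5_colorable :: "'a pair_pre_digraph \<Rightarrow> bool" where
  "C5_colorable G \<longleftrightarrow> graph_homs G C5 \<noteq> {}"

definition C5_colorable_graphs :: "'a pair_pre_digraph set" where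
  "C5_colorable_graphs = {G. pair_graph G \<and> C5_colorable G}"

definition hom_poly :: "'a pair_pre_digraph \<Rightarrow> 'b pair_pre_digraph \<Rightarrow> ('b \<Rightarrow> real) \<Rightarrow> real" where
  "hom_poly F G x = (\<Sum>\<phi> \<in> inj_homs F G. \<Prod>i \<in> \<phi> ` pverts F. x i)"

text \<open>
  Vectors are indexed by the vertex set \<open>V\<close> itself rather than by \<open>{1..n}\<close>; \<open>\<real>\<^sup>V\<close> is the set of
  extensional functions on \<open>V\<close>.
\<close>

definition alpha_sphere :: "'a set \<Rightarrow> real \<Rightarrow> ('a \<Rightarrow> real) set" where
  "alpha_sphere V \<alpha> = {x \<in> V \<rightarrow>\<^sub>E UNIV. (\<Sum>i \<in> V. \<bar>x i\<bar> powr \<alpha>) = 1}"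

text \<open>
  The maximum ranges over an infinite set, so it is expressed by \<^const>\<open>Greatest\<close>
  rather than by \<^const>\<open>Max\<close>; lemma \<open>spectral_radius_is_max\<close> below shows that it is attained.
\<close>

definition spectral_radius ::
    "real \<Rightarrow> 'a pair_pre_digraph \<Rightarrow> 'b pair_pre_digraph \<Rightarrow> real" where
  "spectral_radius \<alpha> F G = (GREATEST m. m \<in> hom_poly F G ` alpha_sphere (pverts G) \<alpha>)"

lemma pair_graph_C5: "pair_graph C5"
  by unfold_locales (auto simp: C5_def Let_def symmetric_def sym_def arcs_ends_conv)

lemma K3_free_iff:
  assumes "pair_graph G"
  shows "K3_free G \<longleftrightarrow> \<not> (\<exists>u v w. (u,v) \<in> parcs G \<and> (v,w) \<in> parcs G \<and> (w,u) \<in> parcs G)"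
proof -
  interpret pair_graph G by fact
  have s: "(a,b) \<in> parcs G \<Longrightarrow> (b,a) \<in> parcs G" for a b
    using pair_sym_arcs by (auto simp: symmetric_def sym_def)
  have wf: "wf_digraph (with_proj G)" by (rule wf_digraph)
  show ?thesis
  proof (intro iffI notI)
    assume "K3_free G" and "\<exists>u v w. (u,v) \<in> parcs G \<and> (v,w) \<in> parcs G \<and> (w,u) \<in> parcs G"
    then obtain u v w where e: "(u,v) \<in> parcs G" "(v,w) \<in> parcs G" "(w,u) \<in> parcs G" by auto
    have d: "u \<noteq> v" "v \<noteq> w" "w \<noteq> u" using e pair_no_loops by fastforce+
    define H where "H = \<lparr>pverts = {u,v,w}, parcs = {(a,b). a \<in> {u,v,w} \<and> b \<in> {u,v,w} \<and> a \<noteq> b}\<rparr>"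
    have "subgraph (with_proj H) (with_proj G)"
      unfolding subgraph_def using wf e s in_arcsD1 in_arcsD2
      by (auto simp: H_def compatible_def wf_digraph_def)
    moreover have "K\<^bsub>3\<^esub> (with_proj H)"
      using d by (auto simp: complete_digraph_pair_def H_def)
    ultimately show False using \<open>K3_free G\<close> by (auto simp: K3_free_def)
  next
    assume n: "\<not> (\<exists>u v w. (u,v) \<in> parcs G \<and> (v,w) \<in> parcs G \<and> (w,u) \<in> parcs G)"
    show "K3_free G" unfolding K3_free_def
    proof
      assume "\<exists>H :: 'a pair_pre_digraph. subgraph H G \<and> K\<^bsub>3\<^esub> H"
      then obtain H :: "'a pair_pre_digraph" where H: "subgraph H G" "K\<^bsub>3\<^esub> H" by auto
      then have c: "card (pverts H) = 3" "parcs H = {(u,v). (u,v) \<in> (pverts H \<times> pverts H) \<and> u \<noteq> v}"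
        by (auto simp: complete_digraph_pair_def)
      obtain a b d where "pverts H = {a,b,d}" "a \<noteq> b" "b \<noteq> d" "a \<noteq> d"
        using c(1) by (auto simp: card_3_iff)
      then have "{(a,b),(b,d),(d,a)} \<subseteq> parcs H" unfolding c(2) by auto
      then have "{(a,b),(b,d),(d,a)} \<subseteq> parcs G" using H(1) by (auto simp: subgraph_def)
      then show False using n by blast
    qed
  qed
qed

text \<open>
  The two maxima in the main statement are well defined: \<^const>\<open>spectral_radius\<close> is an attained
  maximum, and its values on the \<open>C\<^sub>5\<close>-colorable graphs with \<open>n\<close> vertices form a finite nonempty
  set, because it is invariant under relabelling of the vertices.
\<close>

lemma compact_alpha_sphere:
  assumes "finite V" "\<alpha> > 0"
  shows "compact (alpha_sphere V \<alpha> :: ('a \<Rightarrow> real) set)"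
proof -
  have "compactin (product_topology (\<lambda>i::'a. euclidean :: real topology) UNIV)
     (PiE UNIV (\<lambda>i. if i \<in> V then {-1..1} else {undefined}))"
    unfolding compactin_PiE by (auto split: if_splits)
  then have c: "compact (PiE UNIV (\<lambda>i::'a. if i \<in> V then {-1..1::real} else {undefined}))"
    by (simp add: euclidean_product_topology)
  have cont: "continuous_on UNIV (\<lambda>x::'a\<Rightarrow>real. \<Sum>i\<in>V. \<bar>x i\<bar> powr \<alpha>)"
    using assms by (intro continuous_intros continuous_on_powr') (auto intro!: continuous_intros)
  have cl: "closed {x::'a\<Rightarrow>real. (\<Sum>i\<in>V. \<bar>x i\<bar> powr \<alpha>) = 1}"
    by (rule closed_Collect_eq[OF cont]) (rule continuous_intros)
  have b: "\<bar>x j\<bar> \<le> 1" if "(\<Sum>i\<in>V. \<bar>x i\<bar> powr \<alpha>) = 1" "j \<in> V" for x :: "'a \<Rightarrow> real" and j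
  proof (rule ccontr)
    assume "\<not> \<bar>x j\<bar> \<le> 1"
    then have "\<bar>x j\<bar> powr \<alpha> > 1" using assms by (simp add: gr_one_powr)
    moreover have "\<bar>x j\<bar> powr \<alpha> \<le> (\<Sum>i\<in>V. \<bar>x i\<bar> powr \<alpha>)"
      using assms that by (intro member_le_sum) auto
    ultimately show False using that by simp
  qed
  have "alpha_sphere V \<alpha> = PiE UNIV (\<lambda>i. if i \<in> V then {-1..1} else {undefined})
     \<inter> {x::'a\<Rightarrow>real. (\<Sum>i\<in>V. \<bar>x i\<bar> powr \<alpha>) = 1}" (is "?A = ?B")
  proof (intro set_eqI iffI)
    fix x assume "x \<in> ?A"
    then show "x \<in> ?B" using b[of x]
      by (force simp: alpha_sphere_def PiE_iff extensional_def abs_le_iff)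
  next
    fix x assume "x \<in> ?B"
    then show "x \<in> ?A"
      by (auto simp: alpha_sphere_def PiE_iff extensional_def split: if_splits dest: spec)

  qed
  then show ?thesis using compact_Int_closed[OF c cl] by simp
qed

lemma alpha_sphere_nonempty:
  assumes "finite V" "V \<noteq> {}"
  shows "alpha_sphere V \<alpha> \<noteq> {}"
proof -
  obtain v where v: "v \<in> V" using assms by auto
  have "(\<Sum>i\<in>V. \<bar>if i = v then 1 else 0 :: real\<bar> powr \<alpha>) = (\<Sum>i\<in>V. if i = v then 1 else 0)"
    by (intro sum.cong) auto
  then have "restrict (\<lambda>i. if i = v then 1 else 0) V \<in> alpha_sphere V \<alpha>"
    using v assms by (auto simp: alpha_sphere_def)
  then show ?thesis by blast
qed

lemma spectral_radius_is_max:
  assumes "finite (pverts G)" "pverts G \<noteq> {}" "\<alpha> > 0"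
  shows "\<exists>x \<in> alpha_sphere (pverts G) \<alpha>. spectral_radius \<alpha> F G = hom_poly F G x"
    and "\<And>x. x \<in> alpha_sphere (pverts G) \<alpha> \<Longrightarrow> hom_poly F G x \<le> spectral_radius \<alpha> F G"
proof -
  have "continuous_on (alpha_sphere (pverts G) \<alpha>) (hom_poly F G)"
    unfolding hom_poly_def
    by (intro continuous_intros continuous_on_subset[OF continuous_on_product_coordinates]) auto
  then obtain x where x: "x \<in> alpha_sphere (pverts G) \<alpha>"
    "\<And>y. y \<in> alpha_sphere (pverts G) \<alpha> \<Longrightarrow> hom_poly F G y \<le> hom_poly F G x"
    using continuous_attains_sup[OF compact_alpha_sphere alpha_sphere_nonempty] assms by metis
  then have "spectral_radius \<alpha> F G = hom_poly F G x"
    unfolding spectral_radius_def by (intro Greatest_equality) auto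
  with x show "\<exists>x \<in> alpha_sphere (pverts G) \<alpha>. spectral_radius \<alpha> F G = hom_poly F G x"
    and "\<And>x. x \<in> alpha_sphere (pverts G) \<alpha> \<Longrightarrow> hom_poly F G x \<le> spectral_radius \<alpha> F G"
    by auto
qed

definition relabel :: "('a \<Rightarrow> 'b) \<Rightarrow> 'a pair_pre_digraph \<Rightarrow> 'b pair_pre_digraph" where
  "relabel f G = \<lparr>pverts = f ` pverts G, parcs = map_prod f f ` parcs G\<rparr>"

lemma spectral_radius_relabel:
  assumes "pair_graph F" "pair_graph G" and f: "inj_on f (pverts G)"
  shows "spectral_radius \<alpha> F (relabel f G) = spectral_radius \<alpha> F G"
proof -
  interpret F: pair_graph F by fact
  interpret G: pair_graph G by fact
  let ?V = "pverts G" and ?W = "f ` pverts G"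
  define g where "g = inv_into ?V f"
  have gf: "x \<in> ?V \<Longrightarrow> g (f x) = x" for x using f by (simp add: g_def)
  have arcs: "(f u, f v) \<in> parcs (relabel f G) \<longleftrightarrow> (u, v) \<in> parcs G" if "u \<in> ?V" "v \<in> ?V" for u v
  proof
    assume "(f u, f v) \<in> parcs (relabel f G)"
    then obtain a b where ab: "(a,b) \<in> parcs G" "f a = f u" "f b = f v" by (auto simp: relabel_def)
    then have "a = u" "b = v"
      using inj_onD[OF f ab(2) G.in_arcsD1[OF ab(1)]] inj_onD[OF f ab(3) G.in_arcsD2[OF ab(1)]] that by blast+
    then show "(u, v) \<in> parcs G" using ab by simp
  next
    assume "(u, v) \<in> parcs G"
    then show "(f u, f v) \<in> parcs (relabel f G)" by (auto simp: relabel_def intro: rev_image_eqI)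
  qed
  have pv: "pverts (relabel f G) = ?W" by (simp add: relabel_def)
  have hom: "bij_betw (\<lambda>\<phi>. restrict (f \<circ> \<phi>) (pverts F)) (inj_homs F G) (inj_homs F (relabel f G))"
  proof (rule bij_betw_byWitness[where f' = "\<lambda>\<psi>. restrict (g \<circ> \<psi>) (pverts F)"])
    show "\<forall>\<phi>\<in>inj_homs F G. restrict (g \<circ> restrict (f \<circ> \<phi>) (pverts F)) (pverts F) = \<phi>"
      by (auto simp: inj_homs_def graph_homs_def PiE_iff extensional_def fun_eq_iff restrict_def gf)
    show "\<forall>\<psi>\<in>inj_homs F (relabel f G). restrict (f \<circ> restrict (g \<circ> \<psi>) (pverts F)) (pverts F) = \<psi>"
      by (auto simp: inj_homs_def graph_homs_def PiE_iff extensional_def fun_eq_iff restrict_def pv g_def f_inv_into_f)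
    show "(\<lambda>\<phi>. restrict (f \<circ> \<phi>) (pverts F)) ` inj_homs F G \<subseteq> inj_homs F (relabel f G)"
    proof safe
      fix \<phi> assume p: "\<phi> \<in> inj_homs F G"
      then have "inj_on (restrict (f \<circ> \<phi>) (pverts F)) (pverts F)"
        using f by (auto simp: inj_homs_def graph_homs_def PiE_iff inj_on_def)
      moreover have "(f (\<phi> u), f (\<phi> v)) \<in> parcs (relabel f G)" if "(u,v) \<in> parcs F" for u v
      proof -
        have "(\<phi> u, \<phi> v) \<in> parcs G" using p that by (auto simp: inj_homs_def graph_homs_def)
        then show ?thesis using arcs G.in_arcsD1 G.in_arcsD2 by blast
      qed
      ultimately show "restrict (f \<circ> \<phi>) (pverts F) \<in> inj_homs F (relabel f G)"
        using p F.in_arcsD1 F.in_arcsD2 by (auto simp: inj_homs_def graph_homs_def PiE_iff pv)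
    qed
    show "(\<lambda>\<psi>. restrict (g \<circ> \<psi>) (pverts F)) ` inj_homs F (relabel f G) \<subseteq> inj_homs F G"
    proof safe
      fix \<psi> assume p: "\<psi> \<in> inj_homs F (relabel f G)"
      then have r: "u \<in> pverts F \<Longrightarrow> \<psi> u \<in> ?W" for u by (auto simp: inj_homs_def graph_homs_def PiE_iff pv)
      then have gi: "u \<in> pverts F \<Longrightarrow> g (\<psi> u) \<in> ?V \<and> f (g (\<psi> u)) = \<psi> u" for u
        by (simp add: g_def f_inv_into_f inv_into_into)
      have "inj_on (restrict (g \<circ> \<psi>) (pverts F)) (pverts F)"
        
      proof (rule inj_onI)
        fix a b assume a: "a \<in> pverts F" "b \<in> pverts F"
          and e: "restrict (g \<circ> \<psi>) (pverts F) a = restrict (g \<circ> \<psi>) (pverts F) b"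
        from e have "f (g (\<psi> a)) = f (g (\<psi> b))" by (simp add: a)
        then have "\<psi> a = \<psi> b" by (simp only: gi[OF a(1)] gi[OF a(2)])
        then show "a = b" using p a unfolding inj_homs_def by (blast dest: inj_onD)
      qed
      moreover have "(g (\<psi> u), g (\<psi> v)) \<in> parcs G" if "(u,v) \<in> parcs F" for u v
      proof -
        have "u \<in> pverts F" "v \<in> pverts F" using that F.in_arcsD1 F.in_arcsD2 by auto
        moreover have "(\<psi> u, \<psi> v) \<in> parcs (relabel f G)" using p that by (auto simp: inj_homs_def graph_homs_def)
        ultimately show ?thesis using gi arcs by metis
      qed
      ultimately show "restrict (g \<circ> \<psi>) (pverts F) \<in> inj_homs F G"
        using gi F.in_arcsD1 F.in_arcsD2 by (auto simp: inj_homs_def graph_homs_def PiE_iff)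
    qed
  qed
  have poly: "hom_poly F (relabel f G) y = hom_poly F G (restrict (y \<circ> f) ?V)" for y
  proof -
    have "hom_poly F (relabel f G) y
      = (\<Sum>\<phi>\<in>inj_homs F G. \<Prod>i \<in> restrict (f \<circ> \<phi>) (pverts F) ` pverts F. y i)"
      unfolding hom_poly_def by (rule sum.reindex_bij_betw[OF hom, symmetric])
    also have "\<dots> = (\<Sum>\<phi>\<in>inj_homs F G. \<Prod>i \<in> \<phi> ` pverts F. restrict (y \<circ> f) ?V i)"
    proof (rule sum.cong[OF refl])
      fix \<phi> assume "\<phi> \<in> inj_homs F G"
      then have s: "\<phi> ` pverts F \<subseteq> ?V" by (auto simp: inj_homs_def graph_homs_def PiE_iff)
      have "restrict (f \<circ> \<phi>) (pverts F) ` pverts F = f ` (\<phi> ` pverts F)" by auto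
      then show "(\<Prod>i \<in> restrict (f \<circ> \<phi>) (pverts F) ` pverts F. y i)
         = (\<Prod>i \<in> \<phi> ` pverts F. restrict (y \<circ> f) ?V i)"
        using s inj_on_subset[OF f s] by (auto simp: prod.reindex intro!: prod.cong)
    qed
    finally show ?thesis by (simp add: hom_poly_def)
  qed
  have sph: "(\<lambda>y. restrict (y \<circ> f) ?V) ` alpha_sphere ?W \<alpha> = alpha_sphere ?V \<alpha>"
  proof safe
    fix y assume "y \<in> alpha_sphere ?W \<alpha>"
    then show "restrict (y \<circ> f) ?V \<in> alpha_sphere ?V \<alpha>"
      using f by (auto simp: alpha_sphere_def sum.reindex)
  next
    fix x assume x: "x \<in> alpha_sphere ?V \<alpha>"
    have "(\<Sum>i\<in>?W. \<bar>restrict (x \<circ> g) ?W i\<bar> powr \<alpha>) = (\<Sum>i\<in>?V. \<bar>x i\<bar> powr \<alpha>)"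
      using f by (simp add: sum.reindex gf)
    then have "restrict (x \<circ> g) ?W \<in> alpha_sphere ?W \<alpha>" using x by (auto simp: alpha_sphere_def)
    moreover have "x = restrict (restrict (x \<circ> g) ?W \<circ> f) ?V"
      using x by (auto simp: alpha_sphere_def PiE_iff extensional_def fun_eq_iff restrict_def gf)
    ultimately show "x \<in> (\<lambda>y. restrict (y \<circ> f) ?V) ` alpha_sphere ?W \<alpha>" by blast
  qed
  have "hom_poly F (relabel f G) ` alpha_sphere ?W \<alpha> = hom_poly F G ` ((\<lambda>y. restrict (y \<circ> f) ?V) ` alpha_sphere ?W \<alpha>)"
    by (auto simp: poly image_image)
  then show ?thesis unfolding spectral_radius_def pv sph by simp
qed

lemma finite_spectral_radii:
  assumes "pair_graph F" "n > 0"
  shows "finite {spectral_radius \<alpha> F H | H :: 'a pair_pre_digraph. H \<in> C5_colorable_graphs \<and> card (pverts H) = n}"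
proof -
  let ?S = "(\<lambda>A. \<lparr>pverts = {..<n}, parcs = A\<rparr>) ` Pow ({..<n} \<times> {..<n})"
  have "spectral_radius \<alpha> F H \<in> spectral_radius \<alpha> F ` ?S"
    if C: "H \<in> C5_colorable_graphs" and c: "card (pverts H) = n" for H :: "'a pair_pre_digraph"
  proof -
    have H: "pair_graph H" using C by (simp add: C5_colorable_graphs_def)
    then have H': "finite (pverts H)" "parcs H \<subseteq> pverts H \<times> pverts H"
      using pair_fin_digraph.pair_finite_verts pair_graph.axioms(1) pair_digraph.axioms(1)
        pair_wf_digraph.in_arcsD1 pair_wf_digraph.in_arcsD2 pair_fin_digraph.axioms(1)
      by (metis, metis subrelI mem_Sigma_iff)
    obtain f :: "'a \<Rightarrow> nat" where f: "bij_betw f (pverts H) {0..<n}"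
      using ex_bij_betw_finite_nat[OF H'(1)] unfolding c by blast
    then have im: "f ` pverts H = {..<n}" by (simp add: bij_betw_def lessThan_atLeast0)
    have "map_prod f f ` parcs H \<subseteq> map_prod f f ` (pverts H \<times> pverts H)" using H'(2) by (rule image_mono)
    also have "\<dots> = {..<n} \<times> {..<n}" using map_prod_surj_on[OF im im] .
    finally have "relabel f H \<in> ?S" unfolding relabel_def im by blast
    moreover have "spectral_radius \<alpha> F H = spectral_radius \<alpha> F (relabel f H)"
      using spectral_radius_relabel[OF assms(1) H, of f] f by (simp add: bij_betw_def)
    ultimately show ?thesis by simp
  qed
  then have "{spectral_radius \<alpha> F H | H :: 'a pair_pre_digraph. H \<in> C5_colorable_graphs \<and> card (pverts H) = n}
    \<subseteq> spectral_radius \<alpha> F ` ?S" by blast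
  then show ?thesis by (rule finite_subset) auto
qed

lemma nonempty_spectral_radii:
  "{spectral_radius \<alpha> F H | H :: nat pair_pre_digraph. H \<in> C5_colorable_graphs \<and> card (pverts H) = n} \<noteq> {}"
proof -
  let ?H = "\<lparr>pverts = {..<n}, parcs = {}\<rparr> :: nat pair_pre_digraph"
  have "pair_graph ?H" by unfold_locales (auto simp: symmetric_def sym_def arcs_ends_conv)
  moreover have "restrict (\<lambda>_. 1) {..<n} \<in> graph_homs ?H C5"
    by (auto simp: graph_homs_def C5_def Let_def)
  ultimately have "?H \<in> C5_colorable_graphs" by (auto simp: C5_colorable_graphs_def C5_colorable_def)
  then show ?thesis by force
qed

end

theory Submission
  imports Defs
begin

text \<open>
  In a triangle-free graph every homomorphism from \<open>C\<^sub>5\<close> is injective, so the polynomial of the graph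
  is, for weights of total 1, the probability \<open>q\<close> that five independent random vertices form a
  pentagon in this order. In the balanced blow-up of \<open>C\<^sub>5\<close> this pentagon density is \<open>2/625\<close>. The proof
  combines three ideas.

  The first is an inequality \<open>3 p + 610 q \<le> 2\<close> between the density \<open>p\<close> of induced paths on four vertices
  and the pentagon density, tight for the balanced blow-up (\<open>C5_P4_density\<close>). It has a sum-of-squares
  certificate in the style of flag algebras: subtracting averages of squares of linear forms in
  neighbourhood densities from the slack leaves an average over five random vertices
  whose symmetrisation is nonnegative for every triangle-free graph on five vertices.

  The second is stability. In a pentagon the common neighbourhoods of the five pairs at distance two
  are disjoint, so the five codegrees have sum at most 1. Together with \<open>(codegree - 1/5)\<^sup>2 \<ge> 0\<close>, averaged over
  induced paths, this gives \<open>q \<le> p/5\<close> and hence \<open>q \<le> 2/625\<close>; and if \<open>q\<close> is close to \<open>2/625\<close>, then some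
  pentagon has all five codegrees close to \<open>1/5\<close> (\<open>balanced_pentagon\<close>). Its five common neighbourhoods
  cover almost everything and are arranged like a blow-up of \<open>C\<^sub>5\<close>. If moreover every vertex has a
  pentagon degree close to \<open>2/625\<close>, then every vertex is joined to more than half of each of two classes at
  distance two, which places it between them, and adjacent vertices are placed in consecutive
  classes (\<open>C5_coloring_of_pentagon_degree\<close>).

  The third shows that optimal weights on a graph whose spectral radius is at least the maximum over
  \<open>C\<^sub>5\<close>-colorable graphs satisfy this degree condition. The Lagrange condition says that the pentagon degree
  of \<open>v\<close> is the spectral radius times \<open>w v powr (\<alpha> - 1)\<close>. Deleting a light vertex would lose less than the
  upper bound for \<open>n - 1\<close> vertices allows, because the balanced blow-up falls short of the upper bound for
  \<open>n\<close> vertices only by a factor \<open>1 - O(1/n\<^sup>2)\<close>. So all weights are almost at least uniform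
  (\<open>weight_ge\<close>), and all pentagon degrees are almost extremal. A graph that reaches the maximum is therefore
  \<open>C\<^sub>5\<close>-colorable, which yields both the bound and the equality case.
\<close>

section \<open>Averages over random vertices and symmetrisation\<close>

text \<open>
  A functional recursion for symmetrisation is used instead of permutations: \<open>picks\<close> lists all ways
  to take one entry out of a list, and \<open>orderings n\<close> all ways to draw \<open>n\<close> entries in succession.
  Both evaluate quickly on concrete lists, and the averaging argument below is an induction that
  follows this recursion.
\<close>

fun picks :: "'a list \<Rightarrow> ('a \<times> 'a list) list" where
  "picks [] = []"
| "picks (x # xs) = (x, xs) # map (\<lambda>(y, ys). (y, x # ys)) (picks xs)"

fun orderings :: "nat \<Rightarrow> 'a list \<Rightarrow> 'a list list" where
  "orderings 0 xs = [[]]"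
| "orderings (Suc n) xs = concat (map (\<lambda>(y, ys). map ((#) y) (orderings n ys)) (picks xs))"

lemma sum_list_orderings_Suc:
  "(\<Sum>ys\<leftarrow>orderings (Suc n) xs. f ys) = (\<Sum>(y, ys)\<leftarrow>picks xs. \<Sum>zs\<leftarrow>orderings n ys. f (y # zs))"
  for f :: "'a list \<Rightarrow> 'b::comm_monoid_add"
proof -
  have "sum_list (map f (concat yss)) = (\<Sum>ys\<leftarrow>yss. sum_list (map f ys))" for yss
    by (induction yss) auto
  then show ?thesis by (simp add: case_prod_unfold o_def)
qed

lemma mset_picks:
  "mset (map (\<lambda>(y, ys). (y, mset ys)) (picks xs)) = image_mset (\<lambda>y. (y, mset xs - {#y#})) (mset xs)"
proof (induction xs)
  case (Cons x xs)
  have "mset (map (\<lambda>(y, ys). (y, mset ys)) (picks (x # xs)))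
    = add_mset (x, mset xs)
        (image_mset (\<lambda>(y, M). (y, add_mset x M)) (mset (map (\<lambda>(y, ys). (y, mset ys)) (picks xs))))"
    by (simp add: multiset.map_comp o_def case_prod_unfold)
  also have "\<dots> = add_mset (x, mset xs)
      (image_mset (\<lambda>y. (y, add_mset x (mset xs - {#y#}))) (mset xs))"
    unfolding Cons.IH by (simp add: multiset.map_comp o_def)
  also have "image_mset (\<lambda>y. (y, add_mset x (mset xs - {#y#}))) (mset xs)
      = image_mset (\<lambda>y. (y, mset (x # xs) - {#y#})) (mset xs)"
    by (rule image_mset_cong) auto
  finally show ?case by simp
qed simp

lemma sum_list_orderings_cong_mset:
  fixes f :: "'a list \<Rightarrow> 'b::comm_monoid_add"
  assumes "mset xs = mset xs'"
  shows "(\<Sum>ys\<leftarrow>orderings n xs. f ys) = (\<Sum>ys\<leftarrow>orderings n xs'. f ys)"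
  using assms
proof (induction n arbitrary: f xs xs')
  case (Suc n)
  (* By the induction hypothesis, the inner sum depends on the list of remaining entries only through
     its multiset, so it can be evaluated on a chosen representative. *)
  define h where "h = (\<lambda>M. SOME ys :: 'a list. mset ys = M)"
  define g where "g = (\<lambda>y M. \<Sum>zs\<leftarrow>orderings n (h M). f (y # zs))"
  have g: "(\<Sum>zs\<leftarrow>orderings n ys. f (y # zs)) = g y (mset ys)" for y ys
  proof -
    have "mset (h (mset ys)) = mset ys"
      unfolding h_def using someI[of "\<lambda>zs. mset zs = mset ys" ys] by simp
    then show ?thesis unfolding g_def by (intro Suc.IH) simp
  qed
  have "(\<Sum>ys\<leftarrow>orderings (Suc n) xs. f ys) = (\<Sum>y\<in>#mset xs. g y (mset xs - {#y#}))" for xs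
  proof -
    have "(\<Sum>ys\<leftarrow>orderings (Suc n) xs. f ys)
        = sum_list (map (\<lambda>(y, M). g y M) (map (\<lambda>(y, ys). (y, mset ys)) (picks xs)))"
      unfolding sum_list_orderings_Suc by (simp add: g case_prod_unfold o_def)
    also have "\<dots> = sum_mset (image_mset (\<lambda>(y, M). g y M)
        (mset (map (\<lambda>(y, ys). (y, mset ys)) (picks xs))))"
      by (simp only: sum_mset_sum_list[symmetric] mset_map[of "\<lambda>(y, M). g y M"])
    finally show ?thesis unfolding mset_picks by (simp add: multiset.map_comp o_def)
  qed
  then show ?case using Suc.prems by simp
qed simp

lemma picks_map: "picks (map g xs) = map (\<lambda>(y, ys). (g y, map g ys)) (picks xs)"
  by (induction xs) (auto simp: case_prod_unfold)

lemma orderings_map: "orderings n (map g xs) = map (map g) (orderings n xs)"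
  by (induction n arbitrary: xs) (auto simp: picks_map map_concat case_prod_unfold o_def)

text \<open>
  The total weight is not fixed here, because the analytic part changes the weight of one vertex
  and rescales. For total weight 1, \<open>avg\<close> is the expectation over a random vertex, and nested averages
  are expectations over independent random vertices.
\<close>

locale vertex_weights =
  fixes V :: "'a set" and w :: "'a \<Rightarrow> real"
  assumes finite_V: "finite V" and w_nonneg: "v \<in> V \<Longrightarrow> w v \<ge> 0"
begin

definition avg :: "('a \<Rightarrow> real) \<Rightarrow> real" (binder \<open>AVG \<close> 10) where
  "avg f = (\<Sum>v\<in>V. w v * f v)"

lemma avg_zero [simp]: "(AVG v. 0) = 0"
  by (simp add: avg_def)

lemma avg_add: "(AVG v. f v + g v) = (AVG v. f v) + (AVG v. g v)"
  by (simp add: avg_def distrib_left sum.distrib)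

lemma avg_diff: "(AVG v. f v - g v) = (AVG v. f v) - (AVG v. g v)"
  by (simp add: avg_def right_diff_distrib sum_subtractf)

lemma avg_cmult: "(AVG v. c * f v) = c * (AVG v. f v)"
  unfolding avg_def sum_distrib_left by (intro sum.cong) auto

lemma avg_multc: "(AVG v. f v * c) = (AVG v. f v) * c"
  unfolding avg_def sum_distrib_right by (intro sum.cong) auto

lemma avg_sum: "(AVG v. \<Sum>i\<in>I. f i v) = (\<Sum>i\<in>I. AVG v. f i v)"
  unfolding avg_def sum_distrib_left by (rule sum.swap)

lemma avg_swap: "(AVG u v. f u v) = (AVG v u. f u v)"
  unfolding avg_def sum_distrib_left by (subst sum.swap) (simp add: mult_ac)

lemma avg_mono: "(\<And>v. v \<in> V \<Longrightarrow> f v \<le> g v) \<Longrightarrow> (AVG v. f v) \<le> (AVG v. g v)"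
  unfolding avg_def by (intro sum_mono mult_left_mono w_nonneg)

lemma avg_cong: "(\<And>v. v \<in> V \<Longrightarrow> f v = g v) \<Longrightarrow> (AVG v. f v) = (AVG v. g v)"
  unfolding avg_def by (intro sum.cong) auto

lemma avg_nonneg: "(\<And>v. v \<in> V \<Longrightarrow> 0 \<le> f v) \<Longrightarrow> 0 \<le> (AVG v. f v)"
  unfolding avg_def by (intro sum_nonneg mult_nonneg_nonneg w_nonneg)

fun avg_list :: "nat \<Rightarrow> ('a list \<Rightarrow> real) \<Rightarrow> real" where
  "avg_list 0 f = f []"
| "avg_list (Suc n) f = (AVG v. avg_list n (\<lambda>vs. f (v # vs)))"

lemma avg_list_add: "avg_list n (\<lambda>vs. f vs + g vs) = avg_list n f + avg_list n g"
  by (induction n arbitrary: f g) (simp_all add: avg_add)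

lemma avg_list_nonneg:
  "(\<And>vs. set vs \<subseteq> V \<Longrightarrow> length vs = n \<Longrightarrow> 0 \<le> f vs) \<Longrightarrow> 0 \<le> avg_list n f"
  by (induction n arbitrary: f) (auto intro!: avg_nonneg)

text \<open>
  Each of the \<open>n + 1\<close> entries of a random list has the same distribution and is independent of the
  others, so taking out any one of them gives the same average.
\<close>

lemma avg_list_picks:
  "avg_list (Suc n) (\<lambda>vs. \<Sum>(u, us)\<leftarrow>picks vs. f u us) = real (Suc n) * (AVG u. avg_list n (f u))"
proof (induction n arbitrary: f)
  case (Suc n)
  have "avg_list (Suc (Suc n)) (\<lambda>vs. \<Sum>(u, us)\<leftarrow>picks vs. f u us)
    = (AVG v. avg_list (Suc n) (f v)
        + avg_list (Suc n) (\<lambda>vs. \<Sum>(u, us)\<leftarrow>picks vs. f u (v # us)))"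
    by (subst avg_list.simps(2), subst avg_list_add[symmetric])
       (simp only: picks.simps list.map sum_list.Cons map_map o_def case_prod_unfold fst_conv snd_conv)
  also have "\<dots> = (AVG v. avg_list (Suc n) (f v) + real (Suc n) * (AVG u. avg_list n (\<lambda>us. f u (v # us))))"
    by (simp only: Suc.IH)
  also have "\<dots> = (AVG v. avg_list (Suc n) (f v))
      + real (Suc n) * (AVG v u. avg_list n (\<lambda>us. f u (v # us)))"
    by (subst avg_add, subst avg_cmult) (rule refl)
  also have "(AVG v u. avg_list n (\<lambda>us. f u (v # us))) = (AVG u. avg_list (Suc n) (f u))"
    unfolding avg_list.simps by (rule avg_swap)
  finally show ?case
    by (simp only: of_nat_Suc[of "Suc n"] distrib_right mult_1)
qed simp

text \<open>
  Symmetrisation does not change an average: a functional of random vertices may be replaced by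
  its sum over all orders of its arguments. This turns the inequality for averages into an
  inequality for single graphs on five vertices.
\<close>

lemma avg_list_orderings:
  "avg_list n (\<lambda>vs. \<Sum>us\<leftarrow>orderings n vs. f us) = fact n * avg_list n f"
proof (induction n arbitrary: f)
  case (Suc n)
  have "avg_list (Suc n) (\<lambda>vs. \<Sum>us\<leftarrow>orderings (Suc n) vs. f us)
      = real (Suc n) * (AVG u. avg_list n (\<lambda>us. \<Sum>zs\<leftarrow>orderings n us. f (u # zs)))"
    unfolding sum_list_orderings_Suc by (rule avg_list_picks)
  also have "\<dots> = real (Suc n) * (AVG u. fact n * avg_list n (\<lambda>zs. f (u # zs)))"
    by (simp only: Suc.IH)
  also have "\<dots> = fact (Suc n) * (AVG u. avg_list n (\<lambda>zs. f (u # zs)))"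
    by (subst avg_cmult) (simp add: algebra_simps)
  finally show ?case by simp
qed simp

end

locale prob_weights = vertex_weights +
  assumes w_sum: "sum w V = 1"
begin

lemma avg_const [simp]: "(AVG v. c) = c"
  using w_sum by (simp add: avg_def flip: sum_distrib_right)

end

locale weighted_triangle_free = vertex_weights V w for V :: "'a set" and w +
  fixes A :: "'a \<Rightarrow> 'a \<Rightarrow> bool"
  assumes A_sym: "A u v \<Longrightarrow> A v u" and triangle_free: "A u v \<Longrightarrow> A v z \<Longrightarrow> \<not> A u z"

locale prob_triangle_free = weighted_triangle_free + prob_weights

section \<open>A sum-of-squares inequality for pentagons and induced paths\<close>

text \<open>
  A form assigns a coefficient to the set of those of three root vertices \<open>a\<close>, \<open>b\<close>, \<open>c\<close> to which a
  further vertex is adjacent; averaged over the further vertex, it is a linear form in the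
  densities of these eight possibilities.
\<close>

definition form3 :: "int \<Rightarrow> int \<Rightarrow> int \<Rightarrow> int \<Rightarrow> int \<Rightarrow> int \<Rightarrow> int \<Rightarrow> int \<Rightarrow> bool \<Rightarrow> bool \<Rightarrow> bool \<Rightarrow> int" where
  "form3 n a b c ab ac bc abc x y z =
    (if x then if y then if z then abc else ab else if z then ac else a
     else if y then if z then bc else b else if z then c else n)"

text \<open>
  The certificate: for each graph spanned by the roots \<open>a\<close>, \<open>b\<close>, \<open>c\<close>, a list of positive multiples of
  squares of such forms. In the balanced blow-up of \<open>C\<^sub>5\<close> the inequality to be proved is an equality,
  which forces every form to vanish on the densities that occur there. For independent roots these are,
  up to order, \<open>3/5\<close> for no root and \<open>2/5\<close> for all three, or \<open>2/5\<close> for no root and \<open>1/5\<close> each for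
  all three roots, the two roots in the same class, and the third root. The remaining freedom is a
  semidefinite feasibility problem, and the integers below are one of its solutions.
\<close>

definition squares_empty :: "(int \<times> (bool \<Rightarrow> bool \<Rightarrow> bool \<Rightarrow> int)) list" where
  "squares_empty =
    [(400, form3 2 (-5) (-5) (-5) 4 4 4 (-3)), (5760, form3 0 1 (-1) 0 0 1 (-1) 0)]"

definition squares_edge :: "(int \<times> (bool \<Rightarrow> bool \<Rightarrow> bool \<Rightarrow> int)) list" where
  "squares_edge =
    [(2733, form3 2 (-3) (-3) (-1) 0 2 2 0), (1995, form3 2 (-1) (-1) (-2) 0 0 0 0),
     (4125, form3 2 0 0 (-2) 0 (-1) (-1) 0), (83, form3 6 (-4) (-4) (-3) 0 1 1 0),
     (16400, form3 0 1 (-1) 0 0 4 (-4) 0)]"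

definition squares_path :: "(int \<times> (bool \<Rightarrow> bool \<Rightarrow> bool \<Rightarrow> int)) list" where
  "squares_path =
    [(2880, form3 2 1 (-1) 1 0 0 0 0), (620, form3 12 5 (-4) 5 0 (-2) 0 0),
     (6720, form3 0 1 0 (-1) 0 0 0 0)]"

definition squares :: "bool \<Rightarrow> bool \<Rightarrow> bool \<Rightarrow> (int \<times> (bool \<Rightarrow> bool \<Rightarrow> bool \<Rightarrow> int)) list" where
  "squares ab bc ac =
    (if ab then if bc then squares_path else if ac then [] else squares_edge
     else if bc then [] else if ac then [] else squares_empty)"

definition induced_P4 :: "('a \<Rightarrow> 'a \<Rightarrow> bool) \<Rightarrow> 'a \<Rightarrow> 'a \<Rightarrow> 'a \<Rightarrow> 'a \<Rightarrow> bool" where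
  "induced_P4 A a b c d \<longleftrightarrow> A a b \<and> A b c \<and> A c d \<and> \<not> A a d"

definition pentagon :: "('a \<Rightarrow> 'a \<Rightarrow> bool) \<Rightarrow> 'a \<Rightarrow> 'a \<Rightarrow> 'a \<Rightarrow> 'a \<Rightarrow> 'a \<Rightarrow> bool" where
  "pentagon A a b c d e \<longleftrightarrow> A a b \<and> A b c \<and> A c d \<and> A d e \<and> A e a"

text \<open>
  The factors 2400 and 488000 are 800 times the coefficients in \<open>3 p + 610 q \<le> 2\<close>, which clears the
  denominators of the certificate. The two further vertices \<open>d\<close> and \<open>e\<close> carry the two factors of each
  square.
\<close>

definition slack :: "('a \<Rightarrow> 'a \<Rightarrow> bool) \<Rightarrow> 'a \<Rightarrow> 'a \<Rightarrow> 'a \<Rightarrow> 'a \<Rightarrow> 'a \<Rightarrow> int" where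
  "slack A a b c d e = 1600
     - (if induced_P4 A a b c d then 2400 else 0) - (if pentagon A a b c d e then 488000 else 0)
     - (\<Sum>(k, f)\<leftarrow>squares (A a b) (A b c) (A a c).
          k * (f (A a d) (A b d) (A c d) * f (A a e) (A b e) (A c e)))"

fun slack_list :: "('a \<Rightarrow> 'a \<Rightarrow> bool) \<Rightarrow> 'a list \<Rightarrow> int" where
  "slack_list A [a, b, c, d, e] = slack A a b c d e"
| "slack_list A _ = 0"

lemma slack_list_map:
  "slack_list A (map g vs) = slack_list (\<lambda>i j. A (g i) (g j)) vs"
  by (cases "(\<lambda>i j. A (g i) (g j), vs)" rule: slack_list.cases) (simp_all add: slack_def induced_P4_def pentagon_def)


datatype vert = P0 | P1 | P2 | P3 | P4

fun adj5 :: "bool \<Rightarrow> bool \<Rightarrow> bool \<Rightarrow> bool \<Rightarrow> bool \<Rightarrow> bool \<Rightarrow> bool \<Rightarrow> bool \<Rightarrow> bool \<Rightarrow> bool \<Rightarrow> vert \<Rightarrow> vert \<Rightarrow> bool" where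
  "adj5 ab _ _ _ _ _ _ _ _ _ P0 P1 = ab"
| "adj5 _ ac _ _ _ _ _ _ _ _ P0 P2 = ac"
| "adj5 _ _ ad _ _ _ _ _ _ _ P0 P3 = ad"
| "adj5 _ _ _ ae _ _ _ _ _ _ P0 P4 = ae"
| "adj5 ab _ _ _ _ _ _ _ _ _ P1 P0 = ab"
| "adj5 _ _ _ _ bc _ _ _ _ _ P1 P2 = bc"
| "adj5 _ _ _ _ _ bd _ _ _ _ P1 P3 = bd"
| "adj5 _ _ _ _ _ _ be _ _ _ P1 P4 = be"
| "adj5 _ ac _ _ _ _ _ _ _ _ P2 P0 = ac"
| "adj5 _ _ _ _ bc _ _ _ _ _ P2 P1 = bc"
| "adj5 _ _ _ _ _ _ _ cd _ _ P2 P3 = cd"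
| "adj5 _ _ _ _ _ _ _ _ ce _ P2 P4 = ce"
| "adj5 _ _ ad _ _ _ _ _ _ _ P3 P0 = ad"
| "adj5 _ _ _ _ _ bd _ _ _ _ P3 P1 = bd"
| "adj5 _ _ _ _ _ _ _ cd _ _ P3 P2 = cd"
| "adj5 _ _ _ _ _ _ _ _ _ de P3 P4 = de"
| "adj5 _ _ _ ae _ _ _ _ _ _ P4 P0 = ae"
| "adj5 _ _ _ _ _ _ be _ _ _ P4 P1 = be"
| "adj5 _ _ _ _ _ _ _ _ ce _ P4 P2 = ce"
| "adj5 _ _ _ _ _ _ _ _ _ de P4 P3 = de"
| "adj5 _ _ _ _ _ _ _ _ _ _ _ _ = False"

definition has_triangle5 :: "bool \<Rightarrow> bool \<Rightarrow> bool \<Rightarrow> bool \<Rightarrow> bool \<Rightarrow> bool \<Rightarrow> bool \<Rightarrow> bool \<Rightarrow> bool \<Rightarrow> bool \<Rightarrow> bool" where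
  "has_triangle5 ab ac ad ae bc bd be cd ce de \<longleftrightarrow>
     ab \<and> ac \<and> bc \<or> ab \<and> ad \<and> bd \<or> ab \<and> ae \<and> be \<or> ac \<and> ad \<and> cd \<or> ac \<and> ae \<and> ce \<or>
     ad \<and> ae \<and> de \<or> bc \<and> bd \<and> cd \<or> bc \<and> be \<and> ce \<or> bd \<and> be \<and> de \<or> cd \<and> ce \<and> de"

definition increasing_degrees :: "('a \<Rightarrow> 'a \<Rightarrow> bool) \<Rightarrow> 'a list \<Rightarrow> bool" where
  "increasing_degrees A vs \<longleftrightarrow> sorted (map (\<lambda>u. length (filter (A u) vs)) vs)"

lemma increasing_degrees_map:
  "increasing_degrees A (map g vs) = increasing_degrees (\<lambda>i j. A (g i) (g j)) vs"
  by (simp add: increasing_degrees_def filter_map o_def)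

lemma reorder_increasing_degrees: "\<exists>ws. mset ws = mset vs \<and> increasing_degrees A ws"
proof -
  define ws where "ws = sort_key (\<lambda>u. length (filter (A u) vs)) vs"
  have mset: "mset ws = mset vs" by (simp add: ws_def)
  then have "length (filter (A u) ws) = length (filter (A u) vs)" for u
    by (metis mset_filter size_mset)
  moreover have "sorted (map (\<lambda>u. length (filter (A u) vs)) ws)" by (simp add: ws_def)
  ultimately show ?thesis using mset by (auto simp: increasing_degrees_def)
qed

fun slack_check :: "bool list \<Rightarrow> bool" where
  "slack_check [ab, ac, ad, ae, bc, bd, be, cd, ce, de] =
    (if has_triangle5 ab ac ad ae bc bd be cd ce de then True
     else if increasing_degrees (adj5 ab ac ad ae bc bd be cd ce de) [P0, P1, P2, P3, P4]
       then 0 \<le> (\<Sum>vs\<leftarrow>orderings 5 [P0, P1, P2, P3, P4].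
                 slack_list (adj5 ab ac ad ae bc bd be cd ce de) vs)
     else True)"
| "slack_check _ = True"

text \<open>
  The slack itself takes negative values; only its sum over all orders of the five vertices is
  nonnegative, and this is a finite computation. The sum does not depend on the order in which
  the five vertices are given, so it suffices to evaluate it for increasing degrees, which leaves
  44 labelled graphs.
\<close>

lemma slack_check_all: "list_all slack_check (List.n_lists 10 [False, True])"
  by code_simp

text \<open>
  Vertices may coincide here. As a vertex is not adjacent to itself, five vertices with repetitions
  still induce a triangle-free graph on five labels.
\<close>

lemma slack_sum_nonneg_increasing_degrees:
  assumes sym: "\<And>u v. A u v \<Longrightarrow> A v u" and tf: "\<And>u v z. A u v \<Longrightarrow> A v z \<Longrightarrow> \<not> A u z"
    and deg: "increasing_degrees A [a, b, c, d, e]"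
  shows "0 \<le> (\<Sum>vs\<leftarrow>orderings 5 [a, b, c, d, e]. slack_list A vs)"
proof -
  define g where "g = (\<lambda>p. case p of P0 \<Rightarrow> a | P1 \<Rightarrow> b | P2 \<Rightarrow> c | P3 \<Rightarrow> d | P4 \<Rightarrow> e)"
  define R where "R = adj5 (A a b) (A a c) (A a d) (A a e) (A b c) (A b d) (A b e) (A c d) (A c e) (A d e)"
  have irrefl: "\<not> A u u" for u using tf by blast
  have comm: "A u v = A v u" for u v using sym by blast
  have R: "(\<lambda>p q. A (g p) (g q)) = R"
  proof (intro ext)
    fix p q show "A (g p) (g q) = R p q"
      by (cases p; cases q; simp add: g_def R_def irrefl; rule comm)
  qed
  have g: "map g [P0, P1, P2, P3, P4] = [a, b, c, d, e]" by (simp add: g_def)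
  let ?bs = "[A a b, A a c, A a d, A a e, A b c, A b d, A b e, A c d, A c e, A d e]"
  have "?bs \<in> set (List.n_lists 10 [False, True])"
    by (auto simp: set_n_lists)
  then have "slack_check ?bs" using slack_check_all unfolding list_all_iff by blast
  moreover have "\<not> has_triangle5 (A a b) (A a c) (A a d) (A a e) (A b c) (A b d) (A b e) (A c d) (A c e) (A d e)"
    unfolding has_triangle5_def using tf by blast
  moreover have "increasing_degrees R [P0, P1, P2, P3, P4]"
    using deg unfolding g[symmetric] increasing_degrees_map R .
  ultimately have "0 \<le> (\<Sum>vs\<leftarrow>orderings 5 [P0, P1, P2, P3, P4]. slack_list R vs)"
    by (simp add: R_def)
  also have "\<dots> = (\<Sum>vs\<leftarrow>orderings 5 (map g [P0, P1, P2, P3, P4]). slack_list A vs)"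
    unfolding orderings_map by (simp add: slack_list_map R o_def)
  finally show ?thesis unfolding g .
qed

lemma slack_sum_nonneg:
  assumes sym: "\<And>u v. A u v \<Longrightarrow> A v u" and tf: "\<And>u v z. A u v \<Longrightarrow> A v z \<Longrightarrow> \<not> A u z"
    and len: "length vs = 5"
  shows "0 \<le> (\<Sum>us\<leftarrow>orderings 5 vs. slack_list A us)"
proof -
  obtain ws where ws: "mset ws = mset vs" "increasing_degrees A ws"
    using reorder_increasing_degrees by blast
  then have "length ws = 5" using len by (metis size_mset)
  then obtain a b c d e where "ws = [a, b, c, d, e]"
    by (auto simp: numeral_eq_Suc length_Suc_conv)
  then show ?thesis
    using slack_sum_nonneg_increasing_degrees[of A a b c d e] sym tf ws(2)
    unfolding sum_list_orderings_cong_mset[where n = 5 and f = "slack_list A", OF ws(1)[symmetric]] by blast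
qed

context weighted_triangle_free
begin

definition P4_density :: real where
  "P4_density = (AVG a b c d. of_bool (induced_P4 A a b c d))"

definition C5_density :: real where
  "C5_density = (AVG a b c d e. of_bool (pentagon A a b c d e))"

lemma avg_slack_nonneg: "0 \<le> (AVG a b c d e. real_of_int (slack A a b c d e))"
proof -
  have "0 \<le> avg_list 5 (\<lambda>vs. \<Sum>us\<leftarrow>orderings 5 vs. real_of_int (slack_list A us))"
  proof (rule avg_list_nonneg)
    fix vs :: "'a list" assume "length vs = 5"
    then have "0 \<le> real_of_int (\<Sum>us\<leftarrow>orderings 5 vs. slack_list A us)"
      using slack_sum_nonneg[of A vs] A_sym triangle_free by (metis of_int_0_le_iff)
    also have "real_of_int (\<Sum>us\<leftarrow>uss. slack_list A us) = (\<Sum>us\<leftarrow>uss. real_of_int (slack_list A us))" for uss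
      by (induction uss) auto
    finally show "0 \<le> (\<Sum>us\<leftarrow>orderings 5 vs. real_of_int (slack_list A us))" .
  qed
  then have "0 \<le> avg_list 5 (\<lambda>vs. real_of_int (slack_list A vs))"
    unfolding avg_list_orderings using mult_le_cancel_left_pos[of "fact 5 :: real" 0] by simp
  then show ?thesis by (simp add: numeral_eq_Suc)
qed

text \<open>
  For fixed roots, the two further vertices are independent, so the average of the product of two
  copies of a form is the square of its average.
\<close>

lemma avg_squares_nonneg:
  assumes "\<forall>(k, f) \<in> set kfs. k \<ge> (0 :: int)"
  shows "0 \<le> (AVG d e. real_of_int (\<Sum>(k, f)\<leftarrow>kfs. k * (f (A a d) (A b d) (A c d) * f (A a e) (A b e) (A c e))))"
  using assms
proof (induction kfs)
  case (Cons kf kfs)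
  obtain k f where kf: "kf = (k, f)" by (cases kf)
  let ?f = "\<lambda>v. real_of_int (f (A a v) (A b v) (A c v))"
  have "(AVG d e. real_of_int k * (?f d * ?f e)) = real_of_int k * (avg ?f * avg ?f)"
    by (simp only: avg_cmult avg_multc)
  also have "\<dots> \<ge> 0" using Cons.prems kf by simp
  finally show ?case using Cons by (simp add: kf avg_add)
qed simp

end

text \<open>
  In the balanced blow-up of \<open>C\<^sub>5\<close> the two densities are \<open>2/125\<close> and \<open>2/625\<close>, with equality. The
  next part bounds the density of pentagons by that of paths; the two bounds together determine the
  maximal pentagon density.
\<close>

lemma (in prob_triangle_free) C5_P4_density: "3 * P4_density + 610 * C5_density \<le> 2"
proof -
  let ?sq = "\<lambda>a b c d e. real_of_int (\<Sum>(k, f)\<leftarrow>squares (A a b) (A b c) (A a c).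
          k * (f (A a d) (A b d) (A c d) * f (A a e) (A b e) (A c e)))"
  have "real_of_int (slack A a b c d e) = 1600 - 2400 * of_bool (induced_P4 A a b c d)
    - 488000 * of_bool (pentagon A a b c d e) - ?sq a b c d e" for a b c d e
    unfolding slack_def by simp
  then have "(AVG a b c d e. real_of_int (slack A a b c d e))
     = 1600 - 2400 * P4_density - 488000 * C5_density - (AVG a b c d e. ?sq a b c d e)"
    by (simp only: avg_diff avg_cmult avg_const P4_density_def C5_density_def)
  moreover have "0 \<le> (AVG a b c d e. ?sq a b c d e)"
  proof (rule avg_nonneg, rule avg_nonneg, rule avg_nonneg, rule avg_squares_nonneg)
    fix a b c
    show "\<forall>(k, f) \<in> set (squares (A a b) (A b c) (A a c)). 0 \<le> k"
      by (simp add: squares_def squares_empty_def squares_edge_def squares_path_def)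
  qed
  ultimately show ?thesis using avg_slack_nonneg by simp
qed

section \<open>Codegrees along pentagons\<close>

context weighted_triangle_free begin

lemma adj_commute: "A u v \<longleftrightarrow> A v u"
  using A_sym by blast

lemma adj_irrefl: "\<not> A u u"
  using triangle_free by blast

definition codegree :: "'a \<Rightarrow> 'a \<Rightarrow> real" where
  "codegree u v = (AVG z. of_bool (A u z \<and> A z v))"

lemma avg_rotate: "(AVG a b c d e. f b c d e a) = (AVG a b c d e. f a b c d e)"
proof -
  have "(AVG a b c d e. f b c d e a) = (AVG b c d e a. f b c d e a)"
    by (rule trans[OF avg_swap], rule avg_cong, rule trans[OF avg_swap], rule avg_cong,
        rule trans[OF avg_swap], rule avg_cong, rule avg_swap)
  then show ?thesis .
qed

lemma pentagon_iff_P4: "pentagon A a b c d e \<longleftrightarrow> induced_P4 A a b c d \<and> A d e \<and> A e a"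
  using triangle_free[of d e a] adj_commute[of a d] by (auto simp: pentagon_def induced_P4_def)

text \<open>
  A pentagon is an induced path \<open>a b c d\<close> together with a common neighbour of its ends; the ends of
  such a path cannot be adjacent, as the common neighbour would complete a triangle.
\<close>

lemma avg_pentagon_codegree:
  "(AVG a b c d e. of_bool (pentagon A a b c d e) * g (codegree d a))
    = (AVG a b c d. of_bool (induced_P4 A a b c d) * (codegree d a * g (codegree d a)))"
proof (intro avg_cong)
  fix a b c d
  have "of_bool (pentagon A a b c d e) * g (codegree d a)
     = of_bool (induced_P4 A a b c d) * (of_bool (A d e \<and> A e a) * g (codegree d a))" for e
    unfolding pentagon_iff_P4 by simp
  then show "(AVG e. of_bool (pentagon A a b c d e) * g (codegree d a))
     = of_bool (induced_P4 A a b c d) * (codegree d a * g (codegree d a))"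
    by (simp only: avg_cmult avg_multc codegree_def)
qed

lemma C5_density_codegree:
  "C5_density = (AVG a b c d. of_bool (induced_P4 A a b c d) * codegree d a)"
  using avg_pentagon_codegree[of "\<lambda>_. 1"] by (simp add: C5_density_def)

text \<open>
  A pentagon can be read from any of its five vertices, so each of the five pairs at distance two
  contributes the same average.
\<close>

lemma avg_pentagon_cyclic:
  "(AVG a b c d e. of_bool (pentagon A a b c d e) *
      (g (codegree a c) + g (codegree b d) + g (codegree c e) + g (codegree d a) + g (codegree e b)))
    = 5 * (AVG a b c d e. of_bool (pentagon A a b c d e) * g (codegree d a))"
proof -
  define F where "F = (\<lambda>a b c d e. of_bool (pentagon A a b c d e) * g (codegree d a))"
  have F: "(AVG a b c d e. F b c d e a) = (AVG a b c d e. F a b c d e)"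
    "(AVG a b c d e. F c d e a b) = (AVG a b c d e. F a b c d e)"
    "(AVG a b c d e. F d e a b c) = (AVG a b c d e. F a b c d e)"
    "(AVG a b c d e. F e a b c d) = (AVG a b c d e. F a b c d e)"
  proof -
    show 1: "(AVG a b c d e. F b c d e a) = (AVG a b c d e. F a b c d e)"
      by (rule avg_rotate)
    show 2: "(AVG a b c d e. F c d e a b) = (AVG a b c d e. F a b c d e)"
      using avg_rotate[of "\<lambda>a b c d e. F b c d e a"] 1 by simp
    show 3: "(AVG a b c d e. F d e a b c) = (AVG a b c d e. F a b c d e)"
      using avg_rotate[of "\<lambda>a b c d e. F c d e a b"] 2 by simp
    show "(AVG a b c d e. F e a b c d) = (AVG a b c d e. F a b c d e)"
      using avg_rotate[of "\<lambda>a b c d e. F d e a b c"] 3 by simp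
  qed
  have "of_bool (pentagon A a b c d e) *
      (g (codegree a c) + g (codegree b d) + g (codegree c e) + g (codegree d a) + g (codegree e b))
    = F d e a b c + F e a b c d + F a b c d e + F b c d e a + F c d e a b" for a b c d e
  proof -
    have "pentagon A d e a b c = pentagon A a b c d e" "pentagon A e a b c d = pentagon A a b c d e"
      "pentagon A b c d e a = pentagon A a b c d e" "pentagon A c d e a b = pentagon A a b c d e"
      by (auto simp: pentagon_def)
    then show ?thesis by (simp add: F_def algebra_simps)
  qed
  then have "(AVG a b c d e. of_bool (pentagon A a b c d e) *
      (g (codegree a c) + g (codegree b d) + g (codegree c e) + g (codegree d a) + g (codegree e b)))
    = (AVG a b c d e. F d e a b c) + (AVG a b c d e. F e a b c d) + (AVG a b c d e. F a b c d e)
      + (AVG a b c d e. F b c d e a) + (AVG a b c d e. F c d e a b)"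
    by (simp only: avg_add)
  also have "\<dots> = 5 * (AVG a b c d e. F a b c d e)" unfolding F by simp
  finally show ?thesis by (simp only: F_def)
qed

lemma codegree_nonneg: "0 \<le> codegree u v"
  unfolding codegree_def by (rule avg_nonneg) simp

end

context prob_triangle_free begin

lemma codegree_le_1: "codegree u v \<le> 1"
  using avg_mono[of "\<lambda>z. of_bool (A u z \<and> A z v)" "\<lambda>_. 1"] by (simp add: codegree_def)

text \<open>
  The common neighbourhoods of the five pairs at distance two in a pentagon are disjoint: two such
  pairs together contain an edge of the pentagon, and no vertex is adjacent to both of its ends.
\<close>

lemma pentagon_codegree_sum:
  assumes "pentagon A a b c d e"
  shows "codegree a c + codegree b d + codegree c e + codegree d a + codegree e b \<le> 1"
proof -
  have "codegree a c + codegree b d + codegree c e + codegree d a + codegree e b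
     = (AVG z. of_bool (A a z \<and> A z c) + of_bool (A b z \<and> A z d) + of_bool (A c z \<and> A z e)
        + of_bool (A d z \<and> A z a) + of_bool (A e z \<and> A z b))"
    by (simp only: codegree_def avg_add)
  also have "\<dots> \<le> (AVG z. 1)"
  proof (rule avg_mono)
    fix z
    have "\<not> (A a z \<and> A b z)" "\<not> (A b z \<and> A c z)" "\<not> (A c z \<and> A d z)" "\<not> (A d z \<and> A e z)"
      "\<not> (A e z \<and> A a z)"
      using assms triangle_free unfolding pentagon_def by blast+
    moreover have "A z v = A v z" for v by (rule adj_commute)
    ultimately show "of_bool (A a z \<and> A z c) + of_bool (A b z \<and> A z d) + of_bool (A c z \<and> A z e)
        + of_bool (A d z \<and> A z a) + of_bool (A e z \<and> A z b) \<le> (1::real)"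
      by auto
  qed
  finally show ?thesis by simp
qed

text \<open>
  Let \<open>p\<close>, \<open>q\<close>, \<open>T\<close> be the averages over induced paths, that is, over four random vertices with the
  indicator of an induced path as a factor, of 1, of the codegree of the ends, and of the square of
  this codegree; \<open>q\<close> is the pentagon density. The disjointness of common neighbourhoods gives \<open>5 T \<le> q\<close>. Hence the average of \<open>(codegree - 1/5)\<^sup>2\<close> over induced paths, which is
  \<open>T - 2/5 q + p/25\<close>, is at most \<open>(p/5 - q)/5\<close>. Weighting induced paths by codegrees, which are at
  most 1, gives the same bound over pentagons.
\<close>

lemma codegree_deviation:
  "(AVG a b c d e. of_bool (pentagon A a b c d e) *
      ((codegree a c - 1/5)\<^sup>2 + (codegree b d - 1/5)\<^sup>2 + (codegree c e - 1/5)\<^sup>2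
        + (codegree d a - 1/5)\<^sup>2 + (codegree e b - 1/5)\<^sup>2))
    \<le> P4_density / 5 - C5_density"
proof -
  define T where "T = (AVG a b c d e. of_bool (pentagon A a b c d e) * codegree d a)"
  have "5 * T \<le> C5_density"
  proof -
    have "5 * T = (AVG a b c d e. of_bool (pentagon A a b c d e) *
      (codegree a c + codegree b d + codegree c e + codegree d a + codegree e b))"
      unfolding T_def using avg_pentagon_cyclic[of "\<lambda>x. x"] by simp
    also have "\<dots> \<le> C5_density"
      unfolding C5_density_def
      by (intro avg_mono) (use pentagon_codegree_sum in \<open>auto simp: of_bool_def\<close>)
    finally show ?thesis .
  qed
  moreover have "(AVG a b c d. of_bool (induced_P4 A a b c d) * (codegree d a - 1/5)\<^sup>2)
     = T - 2/5 * C5_density + 1/25 * P4_density"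
  proof -
    have "of_bool (induced_P4 A a b c d) * (codegree d a - 1/5)\<^sup>2
      = of_bool (induced_P4 A a b c d) * (codegree d a * codegree d a)
        - 2/5 * (of_bool (induced_P4 A a b c d) * codegree d a)
        + 1/25 * of_bool (induced_P4 A a b c d)" for a b c d
      by (simp add: power2_eq_square field_simps)
    then have "(AVG a b c d. of_bool (induced_P4 A a b c d) * (codegree d a - 1/5)\<^sup>2)
      = (AVG a b c d. of_bool (induced_P4 A a b c d) * (codegree d a * codegree d a))
        - 2/5 * (AVG a b c d. of_bool (induced_P4 A a b c d) * codegree d a)
        + 1/25 * (AVG a b c d. of_bool (induced_P4 A a b c d))"
      by (simp only: avg_add avg_diff avg_cmult)
    then show ?thesis
      using avg_pentagon_codegree[of "\<lambda>x. x"]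
      by (simp only: T_def C5_density_codegree P4_density_def)
  qed
  moreover have "(AVG a b c d e. of_bool (pentagon A a b c d e) * (codegree d a - 1/5)\<^sup>2)
      \<le> (AVG a b c d. of_bool (induced_P4 A a b c d) * (codegree d a - 1/5)\<^sup>2)"
    unfolding avg_pentagon_codegree[of "\<lambda>x. (x - 1/5)\<^sup>2"]
    by (intro avg_mono mult_left_mono mult_left_le_one_le codegree_nonneg codegree_le_1) auto
  ultimately show ?thesis
    unfolding avg_pentagon_cyclic[of "\<lambda>x. (x - 1/5)\<^sup>2"] by simp
qed

lemma codegree_deviation_C5:
  "(AVG a b c d e. of_bool (pentagon A a b c d e) *
      ((codegree a c - 1/5)\<^sup>2 + (codegree b d - 1/5)\<^sup>2 + (codegree c e - 1/5)\<^sup>2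
        + (codegree d a - 1/5)\<^sup>2 + (codegree e b - 1/5)\<^sup>2))
    \<le> (2 - 625 * C5_density) / 15"
  using codegree_deviation C5_P4_density by simp

theorem C5_density_le: "C5_density \<le> 2/625"
proof -
  have "0 \<le> (AVG a b c d e. of_bool (pentagon A a b c d e) *
      ((codegree a c - 1/5)\<^sup>2 + (codegree b d - 1/5)\<^sup>2 + (codegree c e - 1/5)\<^sup>2
        + (codegree d a - 1/5)\<^sup>2 + (codegree e b - 1/5)\<^sup>2))"
    by (intro avg_nonneg) simp
  then show ?thesis using codegree_deviation_C5 by simp
qed

text \<open>
  The tolerances: with deficit \<open>\<epsilon> = 1/10^17\<close> the deviation averages at most \<open>125/3 \<epsilon>\<close>, which is less than
  \<open>1/10^12\<close> times the pentagon density. So on some pentagon the sum of the five squares is at most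
  \<open>1/10^12\<close>.
\<close>

lemma balanced_pentagon:
  assumes "C5_density \<ge> 2/625 - 1/10^17"
  obtains a b c d e where "a \<in> V" "b \<in> V" "c \<in> V" "d \<in> V" "e \<in> V" "pentagon A a b c d e"
    "\<bar>codegree a c - 1/5\<bar> \<le> 1/1000000" "\<bar>codegree b d - 1/5\<bar> \<le> 1/1000000" "\<bar>codegree c e - 1/5\<bar> \<le> 1/1000000"
    "\<bar>codegree d a - 1/5\<bar> \<le> 1/1000000" "\<bar>codegree e b - 1/5\<bar> \<le> 1/1000000"
proof -
  let ?s = "\<lambda>a b c d e. (codegree a c - 1/5)\<^sup>2 + (codegree b d - 1/5)\<^sup>2 + (codegree c e - 1/5)\<^sup>2
        + (codegree d a - 1/5)\<^sup>2 + (codegree e b - 1/5)\<^sup>2"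
  have "\<exists>a\<in>V. \<exists>b\<in>V. \<exists>c\<in>V. \<exists>d\<in>V. \<exists>e\<in>V. pentagon A a b c d e \<and> ?s a b c d e \<le> 1/10^12"
  proof (rule ccontr)
    assume *: "\<not> ?thesis"
    have "(AVG a b c d e. 1/10^12 * of_bool (pentagon A a b c d e))
       \<le> (AVG a b c d e. of_bool (pentagon A a b c d e) * ?s a b c d e)"
    proof (intro avg_mono)
      fix a b c d e assume "a \<in> V" "b \<in> V" "c \<in> V" "d \<in> V" "e \<in> V"
      then have "pentagon A a b c d e \<Longrightarrow> 1/10^12 \<le> ?s a b c d e" using * by (meson linear)
      then show "1/10^12 * of_bool (pentagon A a b c d e) \<le> of_bool (pentagon A a b c d e) * ?s a b c d e"
        by (cases "pentagon A a b c d e") auto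
    qed
    also have "\<dots> \<le> (2 - 625 * C5_density) / 15" by (rule codegree_deviation_C5)
    finally have "1/10^12 * C5_density \<le> (2 - 625 * C5_density) / 15"
      by (simp only: avg_cmult C5_density_def)
    then show False using assms by simp
  qed
  then obtain a b c d e where *: "a \<in> V" "b \<in> V" "c \<in> V" "d \<in> V" "e \<in> V" "pentagon A a b c d e"
      "?s a b c d e \<le> 1/10^12" by blast
  have "\<bar>x\<bar> \<le> 1/1000000" if "x\<^sup>2 + r \<le> 1/10^12" "0 \<le> r" for x r :: real
  proof -
    have "x\<^sup>2 \<le> (1/1000000)\<^sup>2" using that by (simp add: power2_eq_square)
    then show ?thesis using abs_le_square_iff[of x "1/1000000"] by simp
  qed
  note abs = this
  have sq: "0 \<le> (codegree u v - 1/5)\<^sup>2" for u v by simp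
  show ?thesis
  proof (rule that[OF *(1-6)])
    show "\<bar>codegree a c - 1/5\<bar> \<le> 1/1000000"
      by (rule abs[of _ "?s a b c d e - (codegree a c - 1/5)\<^sup>2"]) (use *(7) in simp_all)
    show "\<bar>codegree b d - 1/5\<bar> \<le> 1/1000000"
      by (rule abs[of _ "?s a b c d e - (codegree b d - 1/5)\<^sup>2"]) (use *(7) in simp_all)
    show "\<bar>codegree c e - 1/5\<bar> \<le> 1/1000000"
      by (rule abs[of _ "?s a b c d e - (codegree c e - 1/5)\<^sup>2"]) (use *(7) in simp_all)
    show "\<bar>codegree d a - 1/5\<bar> \<le> 1/1000000"
      by (rule abs[of _ "?s a b c d e - (codegree d a - 1/5)\<^sup>2"]) (use *(7) in simp_all)
    show "\<bar>codegree e b - 1/5\<bar> \<le> 1/1000000"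
      by (rule abs[of _ "?s a b c d e - (codegree e b - 1/5)\<^sup>2"]) (use *(7) in simp_all)
  qed
qed

end

section \<open>Coloring a graph in which all pentagon degrees are large\<close>

context weighted_triangle_free begin

definition pentagon_degree :: "'a \<Rightarrow> real" where
  "pentagon_degree v = (AVG a b c d. of_bool (pentagon A v a b c d))"

lemma C5_density_eq_avg_degree: "C5_density = (AVG v. pentagon_degree v)"
  by (simp only: C5_density_def pentagon_degree_def)

end

definition consecutive :: "nat \<Rightarrow> nat \<Rightarrow> bool" where
  "consecutive i j \<longleftrightarrow> j = Suc i mod 5 \<or> i = Suc j mod 5"

lemma less_5_cases:
  assumes "(j::nat) < 5"
  obtains "j = 0" | "j = 1" | "j = 2" | "j = 3" | "j = 4"
  using assms by linarith

lemma lessThan_5: "{..<5::nat} = {0, 1, 2, 3, 4}"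
  by auto

text \<open>
  The classes \<open>K 0, ..., K 4\<close> are the common neighbourhoods along a balanced pentagon. Inside this
  locale the graph is, up to vertices of total weight at most \<open>5/1000000\<close>, a subgraph of a blow-up of
  \<open>C\<^sub>5\<close> with parts of weight about \<open>1/5\<close>; what remains is to place every single vertex.
\<close>

locale pentagon_classes = prob_triangle_free +
  fixes K :: "nat \<Rightarrow> 'a \<Rightarrow> bool"
  assumes class_unique: "i < 5 \<Longrightarrow> j < 5 \<Longrightarrow> K i u \<Longrightarrow> K j u \<Longrightarrow> i = j"
    and class_edge: "i < 5 \<Longrightarrow> j < 5 \<Longrightarrow> K i u \<Longrightarrow> K j v \<Longrightarrow> A u v \<Longrightarrow> consecutive i j"
    and class_weight: "j < 5 \<Longrightarrow> \<bar>(AVG u. of_bool (K j u)) - 1/5\<bar> \<le> 1/1000000"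
    and degree_large: "v \<in> V \<Longrightarrow> pentagon_degree v \<ge> 2/625 - 1/10^17"
begin

definition class_degree :: "nat \<Rightarrow> 'a \<Rightarrow> real" where
  "class_degree k v = (AVG u. of_bool (A v u \<and> K k u))"

lemma class_degree_nonneg: "0 \<le> class_degree k v"
  unfolding class_degree_def by (rule avg_nonneg) simp

lemma class_degree_le_class: "class_degree k v \<le> (AVG u. of_bool (K k u))"
  unfolding class_degree_def by (rule avg_mono) simp

lemma class_weight_le:
  assumes "k < 5"
  shows "(AVG u. of_bool (K k u)) \<le> 200001/1000000"
  using class_weight[OF assms] by linarith

lemma class_weight_ge:
  assumes "k < 5"
  shows "199999/1000000 \<le> (AVG u. of_bool (K k u))"
  using class_weight[OF assms] by linarith

lemma class_degree_le: "k < 5 \<Longrightarrow> class_degree k v \<le> 200001/1000000"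
  using class_degree_le_class class_weight_le by (rule order_trans)

lemma unclassified_weight: "(AVG u. of_bool (\<forall>j<5. \<not> K j u)) \<le> 5/1000000"
proof -
  have "of_bool (\<forall>j<5. \<not> K j u) = 1 - (\<Sum>j<5. of_bool (K j u) :: real)" for u
  proof (cases "\<exists>j<5. K j u")
    case True
    then obtain j where j: "j < 5" "K j u" by blast
    have "(\<Sum>i<5. of_bool (K i u) :: real) = (\<Sum>i<5. if i = j then 1 else 0)"
      using j class_unique by (intro sum.cong) auto
    then show ?thesis using j by auto
  qed auto
  then have "(AVG u. of_bool (\<forall>j<5. \<not> K j u)) = 1 - (\<Sum>j<5. AVG u. of_bool (K j u))"
    by (simp only: avg_diff avg_const avg_sum)
  also have "\<dots> \<le> 1 - (\<Sum>j<(5::nat). 199999/1000000)"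
    by (intro diff_left_mono sum_mono class_weight_ge) simp
  finally show ?thesis by simp
qed

lemma class_edge_cases:
  assumes "A u v" "i < 5" "K i u" "j < 5" "K j v"
  shows "j = Suc i mod 5 \<or> j = (i + 4) mod 5"
  using class_edge[OF assms(2,4,3,5,1)] assms(2,4)
  by (elim less_5_cases) (simp_all add: consecutive_def)

text \<open>
  A walk of three edges through the classes moves by \<open>\<plusminus>1\<close> or \<open>\<plusminus>3\<close> around the cycle. In the latter case
  it is determined by its ends, which are the classes \<open>k\<close> and \<open>k + 2\<close> and are joined the long way round.
\<close>

lemma pentagon_class_cases:
  assumes "pentagon A v a b c d" and i: "i < 5" "K i a" "i' < 5" "K i' b" "i'' < 5" "K i'' c" "l < 5" "K l d"
  shows "\<exists>k<5. K k a \<and> K (Suc k mod 5) d \<or> K (Suc k mod 5) a \<and> K k d \<or>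
     K k a \<and> K ((k + 4) mod 5) b \<and> K ((k + 3) mod 5) c \<and> K ((k + 2) mod 5) d \<or>
     K ((k + 2) mod 5) a \<and> K ((k + 3) mod 5) b \<and> K ((k + 4) mod 5) c \<and> K k d"
proof -
  have A: "A a b" "A b c" "A c d" using assms(1) by (auto simp: pentagon_def)
  note s = class_edge_cases[OF A(1) i(1-4)] class_edge_cases[OF A(2) i(3-6)] class_edge_cases[OF A(3) i(5-8)]
  have "l = Suc i mod 5 \<or> i = Suc l mod 5 \<or> i' = (i + 4) mod 5 \<and> i'' = (i + 3) mod 5 \<and> l = (i + 2) mod 5
    \<or> i = (l + 2) mod 5 \<and> i' = (l + 3) mod 5 \<and> i'' = (l + 4) mod 5"
    using s i(1) by (elim less_5_cases disjE) simp_all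
  then show ?thesis using i by blast
qed

text \<open>
  Counting the pentagons \<open>v a b c d\<close> by the classes of \<open>a\<close> and \<open>d\<close>: either some vertex is unclassified,
  or \<open>a\<close> and \<open>d\<close> lie in consecutive classes, or they lie in classes at distance two and then \<open>b\<close> and
  \<open>c\<close> are confined to one class each.
\<close>

lemma pentagon_degree_le:
  "pentagon_degree v \<le> 20/1000000 + 2 * (\<Sum>k<5. class_degree k v * class_degree (Suc k mod 5) v)
     + 2 * (200001/1000000)\<^sup>2 * (\<Sum>k<5. class_degree k v * class_degree ((k + 2) mod 5) v)"
proof -
  define U where "U = (\<lambda>u. of_bool (\<forall>j<5. \<not> K j u) :: real)"
  define F where "F = (\<lambda>k u. of_bool (A v u \<and> K k u) :: real)"
  define C where "C = (\<lambda>k u. of_bool (K k u) :: real)"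
  let ?R = "\<lambda>a b c d. \<Sum>k<5. F k a * F (Suc k mod 5) d + F (Suc k mod 5) a * F k d
     + F k a * (C ((k + 4) mod 5) b * (C ((k + 3) mod 5) c * F ((k + 2) mod 5) d))
     + F ((k + 2) mod 5) a * (C ((k + 3) mod 5) b * (C ((k + 4) mod 5) c * F k d))"
  have F0: "0 \<le> F k u" and C0: "0 \<le> C k u" for k u
    by (simp_all add: F_def C_def)
  have R0: "0 \<le> ?R a b c d" for a b c d
    by (intro sum_nonneg add_nonneg_nonneg mult_nonneg_nonneg F0 C0)
  have pw: "of_bool (pentagon A v a b c d) \<le> U a + U b + U c + U d + ?R a b c d" for a b c d
  proof (cases "pentagon A v a b c d")
    case True
    show ?thesis
    proof (cases "(\<exists>j<5. K j a) \<and> (\<exists>j<5. K j b) \<and> (\<exists>j<5. K j c) \<and> (\<exists>j<5. K j d)")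
      case False
      then have "1 \<le> U a + U b + U c + U d" by (auto simp: U_def)
      then show ?thesis using R0[where a = a and b = b and c = c and d = d] True by simp
    next
      case classified: True
      have vad: "A v a" "A v d" using True A_sym by (auto simp: pentagon_def)
      from classified obtain k where k: "k < 5" and *: "K k a \<and> K (Suc k mod 5) d \<or> K (Suc k mod 5) a \<and> K k d \<or>
         K k a \<and> K ((k + 4) mod 5) b \<and> K ((k + 3) mod 5) c \<and> K ((k + 2) mod 5) d \<or>
         K ((k + 2) mod 5) a \<and> K ((k + 3) mod 5) b \<and> K ((k + 4) mod 5) c \<and> K k d"
        using pentagon_class_cases[OF True] by blast
      let ?t = "\<lambda>k. F k a * F (Suc k mod 5) d + F (Suc k mod 5) a * F k d
         + F k a * (C ((k + 4) mod 5) b * (C ((k + 3) mod 5) c * F ((k + 2) mod 5) d))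
         + F ((k + 2) mod 5) a * (C ((k + 3) mod 5) b * (C ((k + 4) mod 5) c * F k d))"
      let ?p1 = "F k a * F (Suc k mod 5) d" and ?p2 = "F (Suc k mod 5) a * F k d"
      let ?p3 = "F k a * (C ((k + 4) mod 5) b * (C ((k + 3) mod 5) c * F ((k + 2) mod 5) d))"
      let ?p4 = "F ((k + 2) mod 5) a * (C ((k + 3) mod 5) b * (C ((k + 4) mod 5) c * F k d))"
      have nn: "0 \<le> ?p1" "0 \<le> ?p2" "0 \<le> ?p3" "0 \<le> ?p4" by (simp_all add: F0 C0)
      have "?p1 = 1 \<or> ?p2 = 1 \<or> ?p3 = 1 \<or> ?p4 = 1"
        using *
      proof (elim disjE)
        assume "K k a \<and> K (Suc k mod 5) d"
        then have "?p1 = 1" using vad by (simp add: F_def)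
        then show ?thesis ..
      next
        assume "K (Suc k mod 5) a \<and> K k d"
        then have "?p2 = 1" using vad by (simp add: F_def)
        then show ?thesis by blast
      next
        assume "K k a \<and> K ((k + 4) mod 5) b \<and> K ((k + 3) mod 5) c \<and> K ((k + 2) mod 5) d"
        then have "?p3 = 1" using vad by (simp add: F_def C_def)
        then show ?thesis by blast
      next
        assume "K ((k + 2) mod 5) a \<and> K ((k + 3) mod 5) b \<and> K ((k + 4) mod 5) c \<and> K k d"
        then have "?p4 = 1" using vad by (simp add: F_def C_def)
        then show ?thesis by blast
      qed
      then have "1 \<le> ?t k" using nn by linarith
      also have "?t k \<le> ?R a b c d"
        using k by (intro member_le_sum) (auto intro!: add_nonneg_nonneg mult_nonneg_nonneg simp: F0 C0)
      finally have "1 \<le> ?R a b c d" .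
      moreover have "0 \<le> U a + U b + U c + U d" by (simp add: U_def)
      ultimately show ?thesis using True by simp
    qed
  next
    case False
    have "0 \<le> U a + U b + U c + U d" by (simp add: U_def)
    then show ?thesis using False R0[where a = a and b = b and c = c and d = d] by simp
  qed
  have avgF: "(AVG u. F k u) = class_degree k v" for k
    by (simp only: F_def class_degree_def)
  have "pentagon_degree v \<le> (AVG a b c d. U a + U b + U c + U d + ?R a b c d)"
    unfolding pentagon_degree_def by (intro avg_mono pw)
  also have "\<dots> = 4 * (AVG u. U u) + (\<Sum>k<5. 2 * (class_degree k v * class_degree (Suc k mod 5) v)
      + class_degree k v * ((AVG u. C ((k + 4) mod 5) u) * ((AVG u. C ((k + 3) mod 5) u) * class_degree ((k + 2) mod 5) v))
      + class_degree ((k + 2) mod 5) v * ((AVG u. C ((k + 3) mod 5) u) * ((AVG u. C ((k + 4) mod 5) u) * class_degree k v)))"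
    by (simp add: avg_add avg_sum avg_cmult avg_multc avgF)
  also have "\<dots> \<le> 4 * (5/1000000) + (\<Sum>k<5. 2 * (class_degree k v * class_degree (Suc k mod 5) v)
      + class_degree k v * (200001/1000000 * (200001/1000000 * class_degree ((k + 2) mod 5) v))
      + class_degree ((k + 2) mod 5) v * (200001/1000000 * (200001/1000000 * class_degree k v)))"
  proof (intro add_mono sum_mono mult_left_mono mult_mono order_refl class_degree_nonneg)
    show "(AVG u. U u) \<le> 5/1000000" unfolding U_def by (rule unclassified_weight)
    have C0: "0 \<le> (AVG u. C k u)" for k by (rule avg_nonneg) (simp add: C_def)
    have C1: "(AVG u. C (k mod 5) u) \<le> 200001/1000000" for k
      unfolding C_def by (rule class_weight_le) simp
    show "(AVG u. C ((k + 3) mod 5) u) \<le> 200001/1000000" "(AVG u. C ((k + 3) mod 5) u) \<le> 200001/1000000"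
      "(AVG u. C ((k + 4) mod 5) u) \<le> 200001/1000000" "(AVG u. C ((k + 4) mod 5) u) \<le> 200001/1000000" for k
      by (rule C1)+
    show "0 \<le> (AVG u. C ((k + 4) mod 5) u) * class_degree k v" for k
      by (intro mult_nonneg_nonneg C0 class_degree_nonneg)
    show "0 \<le> (AVG u. C ((k + 3) mod 5) u) * class_degree ((k + 2) mod 5) v" for k
      by (intro mult_nonneg_nonneg C0 class_degree_nonneg)
  qed (auto intro!: mult_nonneg_nonneg class_degree_nonneg)
  also have "\<dots> = 20/1000000 + 2 * (\<Sum>k<5. class_degree k v * class_degree (Suc k mod 5) v)
     + 2 * (200001/1000000)\<^sup>2 * (\<Sum>k<5. class_degree k v * class_degree ((k + 2) mod 5) v)"
    unfolding sum_distrib_left add.assoc sum.distrib[symmetric]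
    by (intro arg_cong2[where f = "(+)"] sum.cong) (simp_all add: power2_eq_square algebra_simps)
  finally show ?thesis .
qed

text \<open>
  The classified neighbours of a classified vertex lie in the two adjacent classes, so its pentagon degree is at
  most about \<open>2/25\<close> times the product of its two class degrees. Hence both are almost \<open>1/5\<close>, that is,
  the bipartite graphs between consecutive classes are almost complete at every vertex. The constant
  is just below \<open>(2/625 - 20/10^6) / (2/5^3)\<close>.
\<close>

lemma class_degree_member:
  assumes v: "v \<in> V" "j < 5" "K j v"
  shows "class_degree (Suc j mod 5) v \<ge> 1987/10000" "class_degree ((j + 4) mod 5) v \<ge> 1987/10000"
proof -
  have zero: "class_degree k v = 0" if "k < 5" "\<not> consecutive j k" for k
  proof -
    have "(\<lambda>u. of_bool (A v u \<and> K k u) :: real) = (\<lambda>_. 0)"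
      using class_edge[OF v(2) that(1) v(3)] that(2) by (auto simp: fun_eq_iff)
    then show ?thesis unfolding class_degree_def by simp
  qed
  let ?x = "class_degree (Suc j mod 5) v" and ?y = "class_degree ((j + 4) mod 5) v"
  have "(\<Sum>k<5. class_degree k v * class_degree (Suc k mod 5) v) = 0"
    using v(2) zero by (elim less_5_cases) (simp_all add: lessThan_5 consecutive_def)
  moreover have "(\<Sum>k<5. class_degree k v * class_degree ((k + 2) mod 5) v) = ?x * ?y"
    using v(2) zero by (elim less_5_cases) (simp_all add: lessThan_5 consecutive_def)
  ultimately have "2/625 - 1/10^17 \<le> 20/1000000 + 2 * (200001/1000000)\<^sup>2 * (?x * ?y)"
    using pentagon_degree_le[of v] degree_large[OF v(1)] by simp
  then have xy: "(2/625 - 1/10^17 - 20/1000000) / (2 * (200001/1000000)\<^sup>2) \<le> ?x * ?y"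
    by (simp add: field_simps power2_eq_square)
  have b: "?x \<le> 200001/1000000" "?y \<le> 200001/1000000" "0 \<le> ?x" "0 \<le> ?y"
    by (rule class_degree_le, simp)+ (rule class_degree_nonneg)+
  have "?x * ?y \<le> ?x * (200001/1000000)" "?x * ?y \<le> 200001/1000000 * ?y"
    using b by (intro mult_left_mono mult_right_mono; simp)+
  with xy show "?x \<ge> 1987/10000" "?y \<ge> 1987/10000" by (simp_all add: power2_eq_square)
qed

text \<open>
  A neighbour \<open>a\<close> of \<open>v\<close> in one class is adjacent to almost all of the next class, and no vertex there
  can be adjacent to both \<open>a\<close> and \<open>v\<close>. What \<open>a\<close> leaves over has weight at most \<open>200001/10^6 - 1987/10^4\<close>.
\<close>

lemma class_degree_consecutive:
  assumes v: "v \<in> V" "i < 5" "j < 5" "consecutive i j" and pos: "class_degree i v > 0"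
  shows "class_degree j v \<le> 14/10000"
proof -
  obtain a where a: "a \<in> V" "A v a" "K i a"
  proof (rule ccontr)
    assume "\<not> thesis"
    then have "class_degree i v = (AVG u. 0)"
      unfolding class_degree_def using that by (intro avg_cong) auto
    then show False using pos by simp
  qed
  have "class_degree j a \<ge> 1987/10000"
  proof -
    have "(i + 4) mod 5 = j" if "i = Suc j mod 5" using that v(3) by presburger
    then show ?thesis
      using class_degree_member[OF a(1) v(2) a(3)] v(4) unfolding consecutive_def by auto
  qed
  moreover have "class_degree j v + class_degree j a \<le> (AVG u. of_bool (K j u))"
    unfolding class_degree_def avg_add[symmetric]
    by (rule avg_mono) (use triangle_free[OF a(2)] in auto)
  ultimately show ?thesis using class_weight_le[OF v(3)] by simp
qed

text \<open>
  The class degrees of \<open>v\<close> cannot both be large in consecutive classes, so at most two of them are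
  large, and these are at distance two. Then the term of the pentagon degree that contains both
  is responsible for almost all of it, which makes both exceed half the weight of a class.
\<close>

lemma class_exists:
  assumes v: "v \<in> V"
  shows "\<exists>j<5. class_degree (Suc j mod 5) v > 100001/1000000 \<and> class_degree ((j + 4) mod 5) v > 100001/1000000"
proof -
  define x where "x = (\<lambda>k. class_degree k v)"
  define M :: real where "M = 200001/1000000"
  define r :: real where "r = 14/10000"
  have x0: "0 \<le> x k" for k unfolding x_def by (rule class_degree_nonneg)
  have xM: "x k \<le> M" if "k < 5" for k unfolding x_def M_def using that by (rule class_degree_le)
  have small: "x i = 0 \<or> x j \<le> r" if "i < 5" "j < 5" "consecutive i j" for i j
    using class_degree_consecutive[OF v that] x0[of i] unfolding x_def r_def by linarith
  have con: "x k * x (Suc k mod 5) \<le> r * r" and dis: "x k \<le> r \<or> x (Suc k mod 5) \<le> r" if k: "k < 5" for k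
  proof -
    have c: "consecutive k (Suc k mod 5)" "consecutive (Suc k mod 5) k" "Suc k mod 5 < 5"
      by (auto simp: consecutive_def)
    have "r \<ge> 0" by (simp add: r_def)
    have "x k = 0 \<or> x (Suc k mod 5) = 0 \<or> x k \<le> r \<and> x (Suc k mod 5) \<le> r"
      using small[OF k c(3) c(1)] small[OF c(3) k c(2)] by blast
    then show "x k * x (Suc k mod 5) \<le> r * r"
      using x0[of k] x0[of "Suc k mod 5"] \<open>r \<ge> 0\<close> by (auto intro: mult_mono)
    show "x k \<le> r \<or> x (Suc k mod 5) \<le> r"
      using small[OF k c(3) c(1)] \<open>r \<ge> 0\<close> by auto
  qed
  have "(\<Sum>k<5. x k * x (Suc k mod 5)) \<le> (\<Sum>k<(5::nat). r * r)"
    by (intro sum_mono con) simp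
  moreover have "2/625 - 1/10^17 \<le> 20/1000000 + 2 * (\<Sum>k<5. x k * x (Suc k mod 5))
     + 2 * M\<^sup>2 * (\<Sum>k<5. x k * x ((k + 2) mod 5))"
    using pentagon_degree_le[of v] degree_large[OF v] unfolding x_def M_def by linarith
  ultimately have "2/625 - 1/10^17 - 20/1000000 - 10 * (r * r) \<le> 2 * M\<^sup>2 * (\<Sum>k<5. x k * x ((k + 2) mod 5))"
    by simp
  then have sum: "39/1000 \<le> (\<Sum>k<5. x k * x ((k + 2) mod 5))"
    by (simp add: r_def M_def power2_eq_square)
  have prod: "x i * x j \<le> r * M" if "i < 5" "j < 5" "x i \<le> r \<or> x j \<le> r" for i j
  proof -
    have "0 \<le> r" by (simp add: r_def)
    from that(3) show ?thesis
    proof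
      assume "x i \<le> r" then show ?thesis using xM[OF that(2)] x0 \<open>0 \<le> r\<close> by (intro mult_mono)
    next
      assume "x j \<le> r"
      then have "x j * x i \<le> r * M" using xM[OF that(1)] x0 \<open>0 \<le> r\<close> by (intro mult_mono)
      then show ?thesis by (simp only: mult.commute)
    qed
  qed
  (* At most one of the five products of class degrees at distance two has no small factor. *)
  have "\<exists>k\<in>{0, 1, 2, 3, 4}. \<forall>l\<in>{0, 1, 2, 3, 4}. l \<noteq> k \<longrightarrow> x l \<le> r \<or> x ((l + 2) mod 5) \<le> r"
    using dis[of 0] dis[of 1] dis[of 2] dis[of 3] dis[of 4] by (simp add: numeral_2_eq_2) blast
  then obtain k where k: "k < 5" "\<And>l. l < 5 \<Longrightarrow> l \<noteq> k \<Longrightarrow> x l \<le> r \<or> x ((l + 2) mod 5) \<le> r"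
    unfolding lessThan_5[symmetric] by blast
  have "(\<Sum>l<5. x l * x ((l + 2) mod 5)) = x k * x ((k + 2) mod 5) + (\<Sum>l\<in>{..<5} - {k}. x l * x ((l + 2) mod 5))"
    using k(1) by (intro sum.remove) auto
  also have "(\<Sum>l\<in>{..<5} - {k}. x l * x ((l + 2) mod 5)) \<le> (\<Sum>l\<in>{..<5} - {k}. r * M)"
    by (intro sum_mono prod k(2)) auto
  also have "\<dots> = 4 * (r * M)" using k(1) by simp
  finally have "3/100 \<le> x k * x ((k + 2) mod 5)" using sum by (simp add: r_def M_def)
  moreover have "Suc ((k + 1) mod 5) mod 5 = (k + 2) mod 5" "((k + 1) mod 5 + 4) mod 5 = k"
    using k(1) by presburger+
  ultimately have "\<exists>j<5. 3/100 \<le> x (Suc j mod 5) * x ((j + 4) mod 5)"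
    by (intro exI[of _ "(k + 1) mod 5"]) (simp add: mult.commute)
  then obtain j where j: "j < 5" "3/100 \<le> x (Suc j mod 5) * x ((j + 4) mod 5)" by blast
  have "x (Suc j mod 5) * x ((j + 4) mod 5) \<le> x (Suc j mod 5) * M"
    "x (Suc j mod 5) * x ((j + 4) mod 5) \<le> M * x ((j + 4) mod 5)"
    by (intro mult_left_mono mult_right_mono x0 xM; simp)+
  then show ?thesis using j unfolding x_def M_def by (intro exI[of _ j]) simp
qed

text \<open>
  Every vertex is placed in the class between the two classes in which its class degree is large.
  If two adjacent vertices were placed in classes that are not consecutive, then both would be
  joined to more than half of a common class and hence have a common neighbour.
\<close>

lemma C5_coloring: "\<exists>col. (\<forall>v\<in>V. col v < 5) \<and> (\<forall>u\<in>V. \<forall>v\<in>V. A u v \<longrightarrow> consecutive (col u) (col v))"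
proof -
  define good where "good = (\<lambda>j v. j < 5 \<and> class_degree (Suc j mod 5) v > 100001/1000000 \<and> class_degree ((j + 4) mod 5) v > 100001/1000000)"
  have "\<forall>v\<in>V. \<exists>j. good j v" using class_exists by (auto simp: good_def)
  then obtain col where col: "\<And>v. v \<in> V \<Longrightarrow> good (col v) v"
    using bchoice[of V "\<lambda>v j. good j v"] by blast
  have apart: "class_degree k u \<le> 100001/1000000 \<or> class_degree k v \<le> 100001/1000000"
    if "A u v" "k < 5" for k u v
  proof -
    have "class_degree k u + class_degree k v \<le> (AVG z. of_bool (K k z))"
      unfolding class_degree_def avg_add[symmetric]
      by (rule avg_mono) (use triangle_free[OF that(1)] in auto)
    then show ?thesis using class_weight_le[OF that(2)] by linarith
  qed
  have "consecutive (col u) (col v)" if "u \<in> V" "v \<in> V" "A u v" for u v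
  proof (rule ccontr)
    assume "\<not> consecutive (col u) (col v)"
    moreover have lt: "col u < 5" "col v < 5" using col that by (auto simp: good_def)
    ultimately have "Suc (col u) mod 5 = Suc (col v) mod 5 \<or> Suc (col u) mod 5 = (col v + 4) mod 5
      \<or> (col u + 4) mod 5 = Suc (col v) mod 5"
      by (elim less_5_cases) (simp_all add: consecutive_def)
    moreover have "good (col u) u" "good (col v) v" using col that by blast+
    ultimately have "\<exists>k<5. class_degree k u > 100001/1000000 \<and> class_degree k v > 100001/1000000"
      unfolding good_def by (metis mod_less_divisor zero_less_numeral)
    then obtain k where "k < 5" "class_degree k u > 100001/1000000" "class_degree k v > 100001/1000000"
      by blast
    then show False using apart[OF that(3)] by fastforce
  qed
  then show ?thesis using col unfolding good_def by blast
qed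

end

context prob_triangle_free begin

theorem C5_coloring_of_pentagon_degree:
  assumes deg: "\<And>v. v \<in> V \<Longrightarrow> pentagon_degree v \<ge> 2/625 - 1/10^17"
  shows "\<exists>col. (\<forall>v\<in>V. col v < 5) \<and> (\<forall>u\<in>V. \<forall>v\<in>V. A u v \<longrightarrow> consecutive (col u) (col v))"
proof -
  have "2/625 - 1/10^17 = (AVG v. 2/625 - 1/10^17)" by simp
  also have "\<dots> \<le> C5_density"
    unfolding C5_density_eq_avg_degree by (intro avg_mono deg)
  finally obtain a b c d e where p: "pentagon A a b c d e" and cod:
    "\<bar>codegree a c - 1/5\<bar> \<le> 1/1000000" "\<bar>codegree b d - 1/5\<bar> \<le> 1/1000000" "\<bar>codegree c e - 1/5\<bar> \<le> 1/1000000"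
    "\<bar>codegree d a - 1/5\<bar> \<le> 1/1000000" "\<bar>codegree e b - 1/5\<bar> \<le> 1/1000000"
    using balanced_pentagon by metis
  define K where "K = (\<lambda>j z. let (x, y) = [(e, b), (a, c), (b, d), (c, e), (d, a)] ! j in A x z \<and> A y z)"
  have K: "K 0 z \<longleftrightarrow> A e z \<and> A b z" "K 1 z \<longleftrightarrow> A a z \<and> A c z" "K 2 z \<longleftrightarrow> A b z \<and> A d z"
    "K 3 z \<longleftrightarrow> A c z \<and> A e z" "K 4 z \<longleftrightarrow> A d z \<and> A a z" for z
    by (simp_all add: K_def)
  have adj: "\<not> (A a z \<and> A b z)" "\<not> (A b z \<and> A c z)" "\<not> (A c z \<and> A d z)" "\<not> (A d z \<and> A e z)"
      "\<not> (A e z \<and> A a z)" for z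
    using p triangle_free unfolding pentagon_def by blast+
  interpret pentagon_classes V w A K
  proof
    fix i j u assume "i < 5" "j < 5" "K i u" "K j u"
    then show "i = j"
      using adj[of u] by (elim less_5_cases) (simp_all only: K, simp_all)
  next
    fix i j u v assume *: "i < 5" "j < 5" "K i u" "K j v" "A u v"
    have "\<not> (A a u \<and> A a v)" "\<not> (A b u \<and> A b v)" "\<not> (A c u \<and> A c v)" "\<not> (A d u \<and> A d v)" "\<not> (A e u \<and> A e v)"
      using triangle_free[OF _ *(5)] by blast+
    then show "consecutive i j"
      using *(1-4) by (elim less_5_cases) (simp_all only: K, simp_all add: consecutive_def)
  next
    fix j :: nat assume "j < 5"
    then show "\<bar>(AVG u. of_bool (K j u)) - 1/5\<bar> \<le> 1/1000000"
      using cod unfolding codegree_def adj_commute[of _ a] adj_commute[of _ b] adj_commute[of _ c]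
        adj_commute[of _ d] adj_commute[of _ e]
      by (elim less_5_cases) (simp_all only: K)
  qed (rule deg)
  show ?thesis by (rule C5_coloring)
qed

end

section \<open>Optimal weights\<close>

context weighted_triangle_free begin

lemma weighted_triangle_free_weights:
  assumes "\<And>v. v \<in> V \<Longrightarrow> 0 \<le> x v"
  shows "weighted_triangle_free V x A"
  by unfold_locales (rule finite_V, erule assms, erule A_sym, erule (1) triangle_free)

lemma C5_density_cong:
  assumes "\<And>v. v \<in> V \<Longrightarrow> x v = w v"
  shows "weighted_triangle_free.C5_density V x A = C5_density"
proof -
  interpret U: weighted_triangle_free V x A
    using assms w_nonneg by (intro weighted_triangle_free_weights) simp
  have "U.avg f = avg f" for f
    unfolding U.avg_def avg_def using assms by (intro sum.cong) auto
  then show ?thesis unfolding U.C5_density_def C5_density_def by simp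
qed

lemma scaled_densities:
  assumes "0 \<le> s"
  shows "weighted_triangle_free.C5_density V (\<lambda>v. s * w v) A = s ^ 5 * C5_density"
    and "weighted_triangle_free.pentagon_degree V (\<lambda>v. s * w v) A v = s ^ 4 * pentagon_degree v"
proof -
  interpret U: weighted_triangle_free V "\<lambda>v. s * w v" A
    using assms w_nonneg by (intro weighted_triangle_free_weights) simp
  have avg: "U.avg f = s * avg f" for f
    by (simp add: U.avg_def avg_def sum_distrib_left mult.assoc)
  have cmult: "(AVG v. s * f v) = s * (AVG v. f v)" for f by (rule avg_cmult)
  show "U.C5_density = s ^ 5 * C5_density"
    unfolding U.C5_density_def C5_density_def avg cmult by (simp add: numeral_eq_Suc)
  show "U.pentagon_degree v = s ^ 4 * pentagon_degree v"
    unfolding U.pentagon_degree_def pentagon_degree_def avg cmult by (simp add: numeral_eq_Suc)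
qed

lemma avg_rotate4: "(AVG a b c d. f b c d a) = (AVG a b c d. f a b c d)"
proof -
  have "(AVG a b c d. f b c d a) = (AVG b c d a. f b c d a)"
    by (rule trans[OF avg_swap], rule avg_cong, rule trans[OF avg_swap], rule avg_cong, rule avg_swap)
  then show ?thesis .
qed

text \<open>
  No pentagon passes twice through a vertex, so the pentagon density is an affine function of the
  weight of each vertex. The factor 5 counts the positions of the vertex in the pentagon.
\<close>

lemma C5_density_update:
  assumes v: "v \<in> V" and u: "0 \<le> u"
  shows "weighted_triangle_free.C5_density V (w(v := u)) A
    = C5_density + 5 * (u - w v) * pentagon_degree v"
proof -
  interpret U: weighted_triangle_free V "w(v := u)" A
    using u w_nonneg by (intro weighted_triangle_free_weights) simp
  define t where "t = u - w v"
  have up: "U.avg f = avg f + t * f v" for f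
  proof -
    have "U.avg f = (\<Sum>z\<in>V. w z * f z + (if z = v then t * f v else 0))"
      unfolding U.avg_def by (intro sum.cong) (auto simp: t_def algebra_simps)
    also have "\<dots> = avg f + t * f v"
      using v finite_V by (simp add: sum.distrib avg_def)
    finally show ?thesis .
  qed
  define F where "F = (\<lambda>a b c d e. of_bool (pentagon A a b c d e) :: real)"
  have F: "of_bool (pentagon A a b c d e) = F a b c d e" for a b c d e by (simp only: F_def)
  have tri: "A x y \<Longrightarrow> A y z \<Longrightarrow> A z x \<Longrightarrow> False" for x y z
    using triangle_free adj_commute by blast
  have zero: "F v v c d e = 0" "F v b v d e = 0" "F v b c v e = 0" "F v b c d v = 0"
    "F a v v d e = 0" "F a v c v e = 0" "F a v c d v = 0" "F a b v v e = 0" "F a b v d v = 0"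
    "F a b c v v = 0" for a b c d e
    using tri[of v d e] tri[of v b c] tri[of a b v] tri[of v c d] tri[of d e a] tri[of a b c]
      tri[of a v e] tri[of d e v]  tri[of e a v] tri[of b c v] adj_irrefl[of v]
    by (auto simp: F_def pentagon_def)
  (* eta-contracted instances of the same facts, for averages over the last vertex *)
  have zero_fun: "F v v c d = (\<lambda>_. 0)" "F v b v d = (\<lambda>_. 0)" "F v b c v = (\<lambda>_. 0)"
    "F a v v d = (\<lambda>_. 0)" "F a v c v = (\<lambda>_. 0)" "F a b v v = (\<lambda>_. 0)" for a b c d
    using zero by (auto simp: fun_eq_iff)
  have "U.C5_density = C5_density + t * (AVG a b c d. F v a b c d) + t * (AVG a b c d. F a v b c d)
    + t * (AVG a b c d. F a b v c d) + t * (AVG a b c d. F a b c v d) + t * (AVG a b c d. F a b c d v)"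
    unfolding U.C5_density_def C5_density_def F
    by (simp add: up avg_add avg_cmult zero zero_fun algebra_simps)
  moreover have rot: "F a v b c d = F v b c d a" "F a b v c d = F v c d a b" "F a b c v d = F v d a b c"
    "F a b c d v = F v a b c d" for a b c d
    by (auto simp: F_def pentagon_def)
  moreover have 1: "(AVG a b c d. F v b c d a) = (AVG a b c d. F v a b c d)" by (rule avg_rotate4)
  moreover have 2: "(AVG a b c d. F v c d a b) = (AVG a b c d. F v a b c d)"
    using avg_rotate4[of "\<lambda>a b c d. F v b c d a"] 1 by simp
  moreover have "(AVG a b c d. F v d a b c) = (AVG a b c d. F v a b c d)"
    using avg_rotate4[of "\<lambda>a b c d. F v c d a b"] 2 by simp
  moreover have "(AVG a b c d. F v a b c d) = pentagon_degree v"
    by (simp only: F_def pentagon_degree_def)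
  ultimately show ?thesis by (simp add: t_def)
qed

lemma normalized_prob:
  assumes "sum w V > 0"
  shows "prob_triangle_free V (\<lambda>v. 1 / sum w V * w v) A"
proof -
  interpret U: weighted_triangle_free V "\<lambda>v. 1 / sum w V * w v" A
    using assms w_nonneg by (intro weighted_triangle_free_weights) simp
  show ?thesis
    using assms by unfold_locales (simp flip: sum_divide_distrib)
qed

lemma C5_density_le_sum: "C5_density \<le> 2/625 * sum w V ^ 5"
proof (cases "sum w V > 0")
  case True
  interpret N: prob_triangle_free V "\<lambda>v. 1 / sum w V * w v" A by (rule normalized_prob) fact
  have "N.C5_density = (1 / sum w V) ^ 5 * C5_density"
    by (rule scaled_densities) (use True in simp)
  then have "C5_density = sum w V ^ 5 * N.C5_density" using True by (simp only: power_divide) simp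
  also have "\<dots> \<le> sum w V ^ 5 * (2/625)"
    using True by (intro mult_left_mono N.C5_density_le) simp
  finally show ?thesis by simp
next
  case False
  then have "sum w V = 0" using sum_nonneg[of V w] w_nonneg by force
  then have "w v = 0" if "v \<in> V" for v
    using that finite_V w_nonneg by (simp add: sum_nonneg_eq_0_iff)
  then have "avg f = 0" for f by (simp add: avg_def)
  then show ?thesis using \<open>sum w V = 0\<close> by (simp add: C5_density_def)
qed

end

text \<open>
  The power mean inequality, from Young's inequality for each vertex with the mean \<open>\<tau>/n\<close> of the powers.
\<close>

lemma sum_le_power_mean:
  fixes w :: "'a \<Rightarrow> real"
  assumes fin: "finite V" and w: "\<And>v. v \<in> V \<Longrightarrow> 0 \<le> w v" and \<alpha>: "\<alpha> > 1"
  shows "sum w V \<le> card V powr (1 - 1/\<alpha>) * (\<Sum>v\<in>V. w v powr \<alpha>) powr (1/\<alpha>)"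
proof (cases "(\<Sum>v\<in>V. w v powr \<alpha>) = 0")
  case True
  then have "w v = 0" if "v \<in> V" for v
    using that fin by (simp add: sum_nonneg_eq_0_iff)
  then show ?thesis by simp
next
  case False
  define \<tau> where "\<tau> = (\<Sum>v\<in>V. w v powr \<alpha>)"
  define n where "n = real (card V)"
  define \<beta> where "\<beta> = 1 - 1/\<alpha>"
  have \<tau>: "\<tau> > 0" using False by (simp add: \<tau>_def sum_nonneg less_le)
  then have "V \<noteq> {}" by (auto simp: \<tau>_def)
  then have n: "n > 0" using fin by (simp add: n_def card_gt_0_iff)
  define c where "c = \<tau> / n"
  have c: "c > 0" using \<tau> n by (simp add: c_def)
  have \<beta>: "0 < \<beta>" "\<beta> < 1" using \<alpha> by (auto simp: \<beta>_def)
  have "w v * c powr \<beta> \<le> 1/\<alpha> * w v powr \<alpha> + \<beta> * c" if "v \<in> V" for v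
  proof (cases "w v = 0")
    case False
    then have "w v > 0" using w[OF that] by simp
    then show ?thesis
      using Youngs_inequality_0[of "1/\<alpha>" \<beta> "w v powr \<alpha>" c] \<alpha> \<beta> c
      by (simp add: powr_powr \<beta>_def)
  qed (use c \<beta> in simp)
  then have "(\<Sum>v\<in>V. w v * c powr \<beta>) \<le> (\<Sum>v\<in>V. 1/\<alpha> * w v powr \<alpha> + \<beta> * c)"
    by (rule sum_mono)
  also have "\<dots> = 1/\<alpha> * \<tau> + n * (\<beta> * c)"
    by (simp add: sum.distrib \<tau>_def n_def sum_distrib_left)
  also have "\<dots> = \<tau>" using n by (simp add: c_def \<beta>_def field_simps)
  finally have "sum w V * c powr \<beta> \<le> \<tau>" by (simp flip: sum_distrib_right)
  then have "sum w V \<le> \<tau> / c powr \<beta>" using c by (simp add: field_simps)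
  also have "c powr \<beta> = \<tau> powr \<beta> / n powr \<beta>" using \<tau> n by (simp add: c_def powr_divide)
  also have "\<tau> / (\<tau> powr \<beta> / n powr \<beta>) = n powr \<beta> * (\<tau> powr 1 / \<tau> powr \<beta>)" using \<tau> by simp
  also have "\<tau> powr 1 / \<tau> powr \<beta> = \<tau> powr (1/\<alpha>)"
    by (simp only: powr_diff[symmetric]) (simp add: \<beta>_def)
  finally show ?thesis by (simp add: \<tau>_def n_def \<beta>_def)
qed

lemma powr_le_exp:
  fixes y \<beta> :: real
  assumes "0 \<le> y" "y < 1" "0 \<le> \<beta>"
  shows "(1 - y) powr \<beta> \<le> exp (- (\<beta> * y))"
proof -
  have "ln (1 - y) \<le> - y" using ln_le_minus_one[of "1 - y"] assms by simp
  then have "\<beta> * ln (1 - y) \<le> \<beta> * (- y)" using assms by (intro mult_left_mono)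
  then show ?thesis using assms by (simp add: powr_def)
qed

text \<open>
  Weights that attain the maximum on the \<open>\<alpha>\<close>-sphere, with optimality written homogeneously so that
  competitors need not be normalised. The last assumption is the value that the balanced blow-up
  of \<open>C\<^sub>5\<close> on the same number of vertices achieves.
\<close>

locale optimal_weights = weighted_triangle_free +
  fixes \<alpha> :: real
  assumes \<alpha>: "\<alpha> > 1" and norm: "(\<Sum>v\<in>V. w v powr \<alpha>) = 1"
    and optimal: "(\<And>v. v \<in> V \<Longrightarrow> x v \<ge> 0) \<Longrightarrow>
      weighted_triangle_free.C5_density V x A \<le> C5_density * (\<Sum>v\<in>V. x v powr \<alpha>) powr (5/\<alpha>)"
    and card_ge: "card V \<ge> 10"
    and large: "2/625 * (card V powr (1 - 1/\<alpha>)) ^ 5 * exp (- (250 / (card V)\<^sup>2)) \<le> C5_density"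
begin

lemma C5_density_pos: "C5_density > 0"
  by (rule less_le_trans[OF _ large]) (use card_ge in simp)

lemma weight_le_1: "v \<in> V \<Longrightarrow> w v powr \<alpha> \<le> 1"
  using member_le_sum[of v V "\<lambda>v. w v powr \<alpha>"] finite_V norm by simp

text \<open>
  As a function of the weight of \<open>v\<close>, the difference of the two sides of the optimality condition has a
  minimum at the present weight, so its derivative vanishes.
\<close>

lemma Lagrange:
  assumes v: "v \<in> V" "w v > 0"
  shows "pentagon_degree v = C5_density * w v powr (\<alpha> - 1)"
proof -
  let ?L = C5_density and ?D = "pentagon_degree v"
  define g where "g = (\<lambda>u. ?L * (1 - w v powr \<alpha> + u powr \<alpha>) powr (5/\<alpha>) - (?L + 5 * (u - w v) * ?D))"
  have "g (w v) = 0" by (simp add: g_def)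
  have g: "0 \<le> g u" if "0 \<le> u" for u
  proof -
    have "(\<Sum>z\<in>V. (w(v := u)) z powr \<alpha>) = 1 - w v powr \<alpha> + u powr \<alpha>"
      using v finite_V norm by (simp add: sum.remove[of V v])
    then show ?thesis
      using optimal[of "w(v := u)"] C5_density_update[OF v(1) that] w_nonneg that by (simp add: g_def)
  qed
  have "DERIV g (w v) :> ?L * (5/\<alpha> * (1 - w v powr \<alpha> + w v powr \<alpha>) powr (5/\<alpha> - 1) * (\<alpha> * w v powr (\<alpha> - 1))) - 5 * ?D"
  proof -
    have "DERIV (\<lambda>u. 1 - w v powr \<alpha> + u powr \<alpha>) (w v) :> \<alpha> * w v powr (\<alpha> - 1)"
      using v(2) by (auto intro!: derivative_eq_intros)
    from DERIV_fun_powr[OF this, of "5/\<alpha>"]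
    have "DERIV (\<lambda>u. (1 - w v powr \<alpha> + u powr \<alpha>) powr (5/\<alpha>)) (w v)
      :> 5/\<alpha> * (1 - w v powr \<alpha> + w v powr \<alpha>) powr (5/\<alpha> - 1) * (\<alpha> * w v powr (\<alpha> - 1))"
      by simp
    moreover have "DERIV (\<lambda>u. ?L + 5 * (u - w v) * ?D) (w v) :> 5 * ?D"
      by (auto intro!: derivative_eq_intros)
    ultimately show ?thesis
      unfolding g_def by (intro DERIV_diff DERIV_cmult)
  qed
  moreover have "\<forall>u. \<bar>w v - u\<bar> < w v \<longrightarrow> g (w v) \<le> g u"
    using g \<open>g (w v) = 0\<close> by (auto simp: abs_if split: if_splits)
  ultimately have "?L * (5/\<alpha> * (1 - w v powr \<alpha> + w v powr \<alpha>) powr (5/\<alpha> - 1) * (\<alpha> * w v powr (\<alpha> - 1))) - 5 * ?D = 0"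
    using v(2) by (intro DERIV_local_min)
  then show ?thesis using \<alpha> by simp
qed

text \<open>
  No vertex is light. By the Lagrange condition, deleting \<open>v\<close> multiplies the pentagon density by
  \<open>1 - 5 t\<close> with \<open>t = w v powr \<alpha>\<close>, whereas the upper bound for \<open>n - 1\<close> vertices and total power \<open>1 - t\<close>
  drops at least by the factor \<open>exp (- 5 \<beta>/n - 5 t/\<alpha>)\<close> with \<open>\<beta> = 1 - 1/\<alpha>\<close>. Comparing the
  exponents bounds \<open>\<beta> (1/n - t)\<close> by \<open>O(1/n\<^sup>2)\<close>. It is essential here that the balanced blow-up misses the upper
  bound only by a factor \<open>1 - O(1/n\<^sup>2)\<close>.
\<close>

lemma weight_ge:
  assumes v: "v \<in> V"
  shows "1 - 60 / ((1 - 1/\<alpha>) * card V) \<le> card V * w v powr \<alpha>"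
proof -
  define n where "n = real (card V)"
  define \<beta> where "\<beta> = 1 - 1/\<alpha>"
  define t where "t = w v powr \<alpha>"
  have \<beta>: "0 < \<beta>" "\<beta> < 1" using \<alpha> by (auto simp: \<beta>_def)
  have n: "n \<ge> 10" using card_ge by (simp add: n_def)
  have t: "0 \<le> t" "t \<le> 1" using weight_le_1[OF v] by (auto simp: t_def)
  show ?thesis
  proof (cases "n * t \<ge> 1")
    case True
    moreover have "0 \<le> 60 / (\<beta> * n)" using \<beta> n by simp
    ultimately show ?thesis unfolding n_def \<beta>_def t_def by linarith
  next
    case False
    then have tn: "t < 1/n" using n by (simp add: field_simps)
    also have "\<dots> \<le> 1/10" using n by (simp add: field_simps)
    finally have t10: "t < 1/10" .
    interpret U: weighted_triangle_free V "w(v := 0)" A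
      using w_nonneg by (intro weighted_triangle_free_weights) simp
    have "w v * pentagon_degree v = C5_density * t"
    proof (cases "w v = 0")
      case False
      then have "w v > 0" using w_nonneg[OF v] by simp
      then show ?thesis using Lagrange[OF v] by (simp add: t_def powr_mult_base)
    qed (use \<alpha> in \<open>simp add: t_def\<close>)
    then have "C5_density * (1 - 5 * t) = U.C5_density"
      using C5_density_update[OF v, of 0] by (simp add: algebra_simps)
    also have "\<dots> \<le> 2/625 * sum (w(v := 0)) V ^ 5" by (rule U.C5_density_le_sum)
    also have "sum (w(v := 0)) V = sum w (V - {v})"
      using v finite_V by (simp add: sum.remove[of V v])
    also have "2/625 * sum w (V - {v}) ^ 5 \<le> 2/625 * (n powr \<beta> * exp (- (\<beta> / n)) * exp (- (t / \<alpha>))) ^ 5"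
    proof (intro mult_left_mono power_mono)
      have "(\<Sum>z\<in>V - {v}. w z powr \<alpha>) = 1 - t"
        using v finite_V norm by (simp add: sum.remove[of V v] t_def)
      moreover have "real (card (V - {v})) = n * (1 - 1/n)"
      proof -
        have "real (card (V - {v})) = n - 1"
          using v card_ge by (simp add: n_def card_Diff_singleton of_nat_diff)
        then show ?thesis using n by (simp add: right_diff_distrib)
      qed
      ultimately have "sum w (V - {v}) \<le> (n * (1 - 1/n)) powr \<beta> * (1 - t) powr (1/\<alpha>)"
        using sum_le_power_mean[of "V - {v}" w \<alpha>] finite_V w_nonneg \<alpha> by (simp add: \<beta>_def)
      also have "\<dots> = n powr \<beta> * (1 - 1/n) powr \<beta> * (1 - t) powr (1/\<alpha>)"
        using n by (simp add: powr_mult)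
      also have "\<dots> \<le> n powr \<beta> * exp (- (\<beta> * (1/n))) * exp (- (1/\<alpha> * t))"
        using n t t10 \<beta> \<alpha> by (intro mult_mono mult_left_mono powr_le_exp) auto
      finally show "sum w (V - {v}) \<le> n powr \<beta> * exp (- (\<beta> / n)) * exp (- (t / \<alpha>))" by simp
    qed (auto intro: sum_nonneg w_nonneg)
    finally have up: "C5_density * (1 - 5 * t) \<le> 2/625 * (n powr \<beta>) ^ 5 * exp (- (5 * \<beta> / n) - 5 * t / \<alpha>)"
      by (simp add: power_mult_distrib exp_diff exp_minus field_simps flip: exp_of_nat_mult)
    have "exp (- (5 * t) - 2 * (5 * t)\<^sup>2) \<le> 1 - 5 * t"
      using ln_one_minus_pos_lower_bound[of "5 * t"] t t10 by (simp add: ln_ge_iff)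
    moreover have "2/625 * (n powr \<beta>) ^ 5 * exp (- (250 / n\<^sup>2)) \<le> C5_density"
      using large by (simp add: n_def \<beta>_def)
    ultimately have "2/625 * (n powr \<beta>) ^ 5 * exp (- (250 / n\<^sup>2)) * exp (- (5 * t) - 2 * (5 * t)\<^sup>2)
      \<le> C5_density * (1 - 5 * t)"
      using C5_density_pos by (intro mult_mono) auto
    also note up
    finally have "2/625 * (n powr \<beta>) ^ 5 * exp (- (250 / n\<^sup>2) + (- (5 * t) - 2 * (5 * t)\<^sup>2))
      \<le> 2/625 * (n powr \<beta>) ^ 5 * exp (- (5 * \<beta> / n) - 5 * t / \<alpha>)"
      unfolding exp_add by (simp only: mult.assoc)
    moreover have "0 < 2/625 * (n powr \<beta>) ^ 5" using n by simp
    ultimately have "- (250 / n\<^sup>2) + (- (5 * t) - 2 * (5 * t)\<^sup>2) \<le> - (5 * \<beta> / n) - 5 * t / \<alpha>"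
      by (simp only: mult_le_cancel_left_pos exp_le_cancel_iff)
    moreover have "t\<^sup>2 \<le> 1 / n\<^sup>2"
      using power_mono[of t "1/n" 2] t tn by (simp add: power_divide)
    moreover have "t / \<alpha> = t - \<beta> * t" by (simp add: \<beta>_def left_diff_distrib)
    ultimately have "5 * \<beta> / n - 5 * (\<beta> * t) \<le> 300 * (1 / n\<^sup>2)"
      by (simp add: power_mult_distrib)
    then have "(5 * \<beta> / n - 5 * (\<beta> * t)) * (n / (5 * \<beta>)) \<le> 300 * (1 / n\<^sup>2) * (n / (5 * \<beta>))"
      using \<beta> n by (intro mult_right_mono) auto
    also have "(5 * \<beta> / n - 5 * (\<beta> * t)) * (n / (5 * \<beta>)) = 1 - n * t"
      using \<beta> n by (simp add: field_simps)
    also have "300 * (1 / n\<^sup>2) * (n / (5 * \<beta>)) = 60 / (\<beta> * n)"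
      using \<beta> n by (simp add: field_simps power2_eq_square)
    finally show ?thesis unfolding n_def \<beta>_def t_def by linarith
  qed
qed

text \<open>
  By the Lagrange condition the pentagon degree is monotone in the weight, so the lower bound for weights
  makes all pentagon degrees almost extremal. The accuracy \<open>1/10^15\<close> is chosen so that
  \<open>2/625 (1 - 1/10^15) \<ge> 2/625 - 1/10^17\<close>.
\<close>

lemma pentagon_degree_ge:
  assumes n_large: "exp (- (250 / (card V)\<^sup>2)) * (1 - 60 / ((1 - 1/\<alpha>) * card V)) \<ge> 1 - 1/10^15"
    and v: "v \<in> V"
  shows "(2/625 - 1/10^17) * sum w V ^ 4 \<le> pentagon_degree v"
proof -
  define n where "n = real (card V)"
  define \<beta> where "\<beta> = 1 - 1/\<alpha>"
  define q where "q = 1 - 60 / (\<beta> * n)"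
  define E where "E = exp (- (250 / n\<^sup>2))"
  have \<beta>: "0 < \<beta>" "\<beta> < 1" using \<alpha> by (auto simp: \<beta>_def)
  have n: "n \<ge> 10" using card_ge by (simp add: n_def)
  have Eq: "1 - 1/10^15 \<le> E * q" and E: "0 < E" using n_large by (simp_all add: E_def q_def n_def \<beta>_def)
  have "0 < E * q" by (rule less_le_trans[OF _ Eq]) simp
  then have q: "0 < q" using E by (simp add: zero_less_mult_iff)
  have q1: "q \<le> 1" using \<beta> n by (simp add: q_def)
  have "q / n \<le> w v powr \<alpha>"
    using weight_ge[OF v] n by (simp add: q_def n_def \<beta>_def field_simps)
  moreover from this have "w v \<noteq> 0" using q n by (auto simp: field_simps)
  then have wv: "w v > 0" using w_nonneg[OF v] by simp
  ultimately have "(q / n) powr \<beta> \<le> (w v powr \<alpha>) powr \<beta>"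
    using \<beta> q n by (intro powr_mono2) auto
  also have "\<dots> = w v powr (\<alpha> - 1)"
  proof -
    have "\<alpha> * \<beta> = \<alpha> - 1" using \<alpha> by (simp add: \<beta>_def right_diff_distrib)
    then show ?thesis by (simp add: powr_powr)
  qed
  finally have "q powr \<beta> / n powr \<beta> \<le> w v powr (\<alpha> - 1)"
    using q n by (simp add: powr_divide)
  moreover have "q powr 1 \<le> q powr \<beta>" using q q1 \<beta> by (intro powr_mono') auto
  ultimately have wq: "q / n powr \<beta> \<le> w v powr (\<alpha> - 1)"
    using q n divide_right_mono[of "q" "q powr \<beta>" "n powr \<beta>"] by simp
  have "sum w V \<le> n powr \<beta>"
    using sum_le_power_mean[of V w \<alpha>] finite_V w_nonneg \<alpha> norm by (simp add: n_def \<beta>_def)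
  then have "(2/625 - 1/10^17) * sum w V ^ 4 \<le> (2/625 * (E * q)) * (n powr \<beta>) ^ 4"
    using Eq by (intro mult_mono power_mono) (auto intro: sum_nonneg w_nonneg)
  also have "\<dots> = (2/625 * (n powr \<beta>) ^ 5 * E) * (q / n powr \<beta>)"
    using n by (simp add: field_simps numeral_eq_Suc)
  also have "\<dots> \<le> C5_density * w v powr (\<alpha> - 1)"
    using large wq q E C5_density_pos by (intro mult_mono) (auto simp: n_def \<beta>_def E_def)
  also have "\<dots> = pentagon_degree v" using Lagrange[OF v wv] by simp
  finally show ?thesis .
qed

lemma C5_coloring_optimal:
  assumes n_large: "exp (- (250 / (card V)\<^sup>2)) * (1 - 60 / ((1 - 1/\<alpha>) * card V)) \<ge> 1 - 1/10^15"
  shows "\<exists>col. (\<forall>v\<in>V. col v < 5) \<and> (\<forall>u\<in>V. \<forall>v\<in>V. A u v \<longrightarrow> consecutive (col u) (col v))"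
proof -
  have "0 < 2/625 * sum w V ^ 5" using C5_density_pos C5_density_le_sum by (rule less_le_trans)
  then have s: "sum w V > 0"
    using sum_nonneg[of V w] w_nonneg by (cases "sum w V = 0") (auto simp: less_le)
  interpret N: prob_triangle_free V "\<lambda>v. 1 / sum w V * w v" A by (rule normalized_prob[OF s])
  have "2/625 - 1/10^17 \<le> N.pentagon_degree v" if "v \<in> V" for v
  proof -
    have "N.pentagon_degree v = (1 / sum w V) ^ 4 * pentagon_degree v"
      by (rule scaled_densities) (use s in simp)
    then have "pentagon_degree v = N.pentagon_degree v * sum w V ^ 4"
      using s by (simp only: power_divide) simp
    then have "(2/625 - 1/10^17) * sum w V ^ 4 \<le> N.pentagon_degree v * sum w V ^ 4"
      using pentagon_degree_ge[OF n_large that] by simp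
    then show ?thesis by (rule mult_right_le_imp_le) (use s in simp)
  qed
  then show ?thesis by (rule N.C5_coloring_of_pentagon_degree)
qed

end

section \<open>Graphs, blow-ups and the spectral radius\<close>

abbreviation adjacent :: "'a pair_pre_digraph \<Rightarrow> 'a \<Rightarrow> 'a \<Rightarrow> bool" where
  "adjacent G \<equiv> \<lambda>u v. (u, v) \<in> parcs G"

lemma weighted_triangle_free_graph:
  assumes G: "pair_graph G" "K3_free G" and x: "\<And>v. v \<in> pverts G \<Longrightarrow> 0 \<le> x v"
  shows "weighted_triangle_free (pverts G) x (adjacent G)"
proof -
  interpret pair_graph G by fact
  have s: "(u, v) \<in> parcs G \<Longrightarrow> (v, u) \<in> parcs G" for u v
    using pair_sym_arcs by (auto simp: symmetric_def sym_def)
  show ?thesis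
  proof
    fix u v z assume "(u, v) \<in> parcs G" "(v, z) \<in> parcs G"
    then show "(u, z) \<notin> parcs G" using G s unfolding K3_free_iff[OF G(1)] by blast
  qed (use x s pair_finite_verts in auto)
qed

lemma C5_simps: "pverts C5 = {1, 2, 3, 4, 5}"
  "parcs C5 = {(1,2), (2,3), (3,4), (4,5), (5,1), (2,1), (3,2), (4,3), (5,4), (1,5)}"
  by (auto simp: C5_def Let_def)

text \<open>
  In a triangle-free graph a homomorphism from \<open>C\<^sub>5\<close> is injective: identifying two vertices at distance two
  would leave a closed walk of length three.
\<close>

lemma hom_poly_C5:
  assumes G: "pair_graph G" "K3_free G" and x: "\<And>v. v \<in> pverts G \<Longrightarrow> 0 \<le> x v"
  shows "hom_poly C5 G x = weighted_triangle_free.C5_density (pverts G) x (adjacent G)"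
proof -
  interpret W: weighted_triangle_free "pverts G" x "adjacent G"
    by (rule weighted_triangle_free_graph) fact+
  define V where "V = pverts G"
  define T where "T = {(a, b, c, d, e) \<in> V \<times> V \<times> V \<times> V \<times> V. pentagon (adjacent G) a b c d e}"
  define X where "X = (\<lambda>a b c d e. x a * (x b * (x c * (x d * x e))))"
  have distinct: "a \<noteq> b \<and> a \<noteq> c \<and> a \<noteq> d \<and> a \<noteq> e \<and> b \<noteq> c \<and> b \<noteq> d \<and> b \<noteq> e \<and> c \<noteq> d \<and> c \<noteq> e \<and> d \<noteq> e"
    if "pentagon (adjacent G) a b c d e" for a b c d e
    using that W.triangle_free W.A_sym unfolding pentagon_def by metis
  have hom: "\<phi> \<in> inj_homs C5 G \<longleftrightarrow> \<phi> \<in> extensional {1, 2, 3, 4, 5} \<and> (\<phi> 1, \<phi> 2, \<phi> 3, \<phi> 4, \<phi> 5) \<in> T" for \<phi>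
  proof
    assume "\<phi> \<in> inj_homs C5 G"
    then show "\<phi> \<in> extensional {1, 2, 3, 4, 5} \<and> (\<phi> 1, \<phi> 2, \<phi> 3, \<phi> 4, \<phi> 5) \<in> T"
      by (auto simp: inj_homs_def graph_homs_def C5_simps PiE_iff T_def V_def pentagon_def)
  next
    assume *: "\<phi> \<in> extensional {1, 2, 3, 4, 5} \<and> (\<phi> 1, \<phi> 2, \<phi> 3, \<phi> 4, \<phi> 5) \<in> T"
    then have "pentagon (adjacent G) (\<phi> 1) (\<phi> 2) (\<phi> 3) (\<phi> 4) (\<phi> 5)" by (simp add: T_def)
    from distinct[OF this] have "inj_on \<phi> {1, 2, 3, 4, 5}" by (auto simp: inj_on_def)
    with * show "\<phi> \<in> inj_homs C5 G"
      using W.A_sym by (auto simp: inj_homs_def graph_homs_def C5_simps PiE_iff T_def V_def pentagon_def)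
  qed
  have "hom_poly C5 G x = (\<Sum>(a, b, c, d, e)\<in>T. X a b c d e)"
    unfolding hom_poly_def
  proof (rule sum.reindex_bij_witness[where
        i = "\<lambda>(a, b, c, d, e). restrict (\<lambda>j. [a, b, c, d, e] ! (j - 1)) {1, 2, 3, 4, 5}"
        and j = "\<lambda>\<phi>. (\<phi> 1, \<phi> 2, \<phi> 3, \<phi> 4, \<phi> 5)"])
    fix \<phi> assume phi: "\<phi> \<in> inj_homs C5 G"
    then show "(case (\<phi> 1, \<phi> 2, \<phi> 3, \<phi> 4, \<phi> 5) of (a, b, c, d, e) \<Rightarrow>
        restrict (\<lambda>j. [a, b, c, d, e] ! (j - 1)) {1, 2, 3, 4, 5}) = \<phi>"
      unfolding hom by (auto simp: extensional_def fun_eq_iff)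
    show "(\<phi> 1, \<phi> 2, \<phi> 3, \<phi> 4, \<phi> 5) \<in> T" using phi hom by blast
    have inj: "inj_on \<phi> {1, 2, 3, 4, 5}" using phi by (simp add: inj_homs_def C5_simps)
    have "(\<Prod>i\<in>\<phi> ` {1, 2, 3, 4, 5}. x i) = X (\<phi> 1) (\<phi> 2) (\<phi> 3) (\<phi> 4) (\<phi> 5)"
      unfolding prod.reindex[OF inj] by (simp add: X_def)
    then show "(case (\<phi> 1, \<phi> 2, \<phi> 3, \<phi> 4, \<phi> 5) of (a, b, c, d, e) \<Rightarrow> X a b c d e) = (\<Prod>i\<in>\<phi> ` pverts C5. x i)"
      by (simp add: C5_simps)
  next
    fix p assume p: "p \<in> T"
    then show "(case p of (a, b, c, d, e) \<Rightarrow> restrict (\<lambda>j. [a, b, c, d, e] ! (j - 1)) {1, 2, 3, 4, 5}) \<in> inj_homs C5 G"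
      unfolding hom by (cases p) simp
    show "(\<lambda>\<phi>. (\<phi> 1, \<phi> 2, \<phi> 3, \<phi> 4, \<phi> 5))
      (case p of (a, b, c, d, e) \<Rightarrow> restrict (\<lambda>j. [a, b, c, d, e] ! (j - 1)) {1, 2, 3, 4, 5}) = p"
      by (cases p) simp
  qed
  also have "\<dots> = (\<Sum>(a, b, c, d, e)\<in>V \<times> V \<times> V \<times> V \<times> V.
      X a b c d e * of_bool (pentagon (adjacent G) a b c d e))"
    using W.finite_V by (intro sum.mono_neutral_cong_left) (auto simp: T_def V_def)
  also have "\<dots> = (\<Sum>a\<in>V. \<Sum>b\<in>V. \<Sum>c\<in>V. \<Sum>d\<in>V. \<Sum>e\<in>V. X a b c d e * of_bool (pentagon (adjacent G) a b c d e))"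
    by (simp add: sum.cartesian_product)
  also have "\<dots> = W.C5_density"
    unfolding W.C5_density_def W.avg_def X_def V_def sum_distrib_left by (simp add: mult.assoc)
  finally show ?thesis .
qed

lemma C5_colorable_graphs_coloring:
  assumes G: "pair_graph G" and col: "\<And>v. v \<in> pverts G \<Longrightarrow> col v < (5::nat)"
    and edge: "\<And>u v. (u, v) \<in> parcs G \<Longrightarrow> consecutive (col u) (col v)"
  shows "G \<in> C5_colorable_graphs"
proof -
  interpret pair_graph G by fact
  have C: "(Suc i, Suc j) \<in> parcs C5" if "i < 5" "j < 5" "consecutive i j" for i j
    using that by (elim less_5_cases) (simp_all add: consecutive_def C5_simps)
  have V: "Suc i \<in> pverts C5" if "i < 5" for i
    using that by (elim less_5_cases) (simp_all add: C5_simps)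
  have "(\<lambda>v\<in>pverts G. Suc (col v)) \<in> graph_homs G C5"
    unfolding graph_homs_def using C V col edge in_arcsD1 in_arcsD2 by (auto simp: PiE_iff)
  then show ?thesis using G by (auto simp: C5_colorable_graphs_def C5_colorable_def)
qed

definition C5_blowup :: "nat \<Rightarrow> nat pair_pre_digraph" where
  "C5_blowup n = \<lparr>pverts = {..<n},
     parcs = {(u, v). u < n \<and> v < n \<and> consecutive (u mod 5) (v mod 5)}\<rparr>"

lemma consecutive_sym: "consecutive i j \<Longrightarrow> consecutive j i"
  by (auto simp: consecutive_def)

lemma consecutive_triangle_free:
  assumes "i < 5" "j < 5" "k < 5" "consecutive i j" "consecutive j k"
  shows "\<not> consecutive k i"
  using assms by (elim less_5_cases) (simp_all add: consecutive_def)

lemma pair_graph_C5_blowup: "pair_graph (C5_blowup n)"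
proof -
  have "\<not> consecutive (u mod 5) (u mod 5)" for u
    using consecutive_triangle_free[of "u mod 5" "u mod 5" "u mod 5"] by auto
  moreover have "finite {(u, v). u < n \<and> v < n \<and> consecutive (u mod 5) (v mod 5)}"
    by (rule finite_subset[of _ "{..<n} \<times> {..<n}"]) auto
  ultimately show ?thesis
    by unfold_locales
      (auto simp: C5_blowup_def symmetric_def sym_def arcs_ends_conv intro: consecutive_sym)
qed

lemma C5_blowup_colorable: "C5_blowup n \<in> C5_colorable_graphs"
  by (rule C5_colorable_graphs_coloring[where col = "\<lambda>v. v mod 5"])
     (rule pair_graph_C5_blowup, simp_all add: C5_blowup_def)

lemma K3_free_C5_blowup: "K3_free (C5_blowup n)"
  unfolding K3_free_iff[OF pair_graph_C5_blowup]
proof (intro notI, elim exE conjE)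
  fix u v z
  assume "(u, v) \<in> parcs (C5_blowup n)" "(v, z) \<in> parcs (C5_blowup n)" "(z, u) \<in> parcs (C5_blowup n)"
  then have "consecutive (u mod 5) (v mod 5)" "consecutive (v mod 5) (z mod 5)" "consecutive (z mod 5) (u mod 5)"
    by (simp_all add: C5_blowup_def)
  then show False using consecutive_triangle_free[of "u mod 5" "v mod 5" "z mod 5"] by simp
qed

lemma residue_class_card:
  assumes "j < 5"
  shows "card {u. u < n \<and> u mod 5 = j} = (n + 4 - j) div 5"
proof -
  have "{u. u < n \<and> u mod 5 = j} = (\<lambda>k. 5 * k + j) ` {..<(n + 4 - j) div 5}"
  proof safe
    fix u assume u: "u < n" "j = u mod 5"
    have "Suc (u div 5) * 5 + u mod 5 = 5 + (u div 5 * 5 + u mod 5)" by (simp only: mult_Suc add.assoc)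
    also have "\<dots> = 5 + u" by (simp only: div_mult_mod_eq)
    finally have "Suc (u div 5) * 5 + u mod 5 \<le> n + 4" using u(1) by simp
    then have "Suc (u div 5) * 5 \<le> n + 4 - u mod 5" by (rule add_le_imp_le_diff)
    then have "u div 5 < (n + 4 - u mod 5) div 5"
      by (simp only: Suc_le_eq[symmetric] less_eq_div_iff_mult_less_eq zero_less_numeral)
    moreover have "u = 5 * (u div 5) + u mod 5" by simp
    ultimately show "u \<in> (\<lambda>k. 5 * k + u mod 5) ` {..<(n + 4 - u mod 5) div 5}" by blast
  next
    fix k assume "k < (n + 4 - j) div 5"
    then have "Suc k * 5 \<le> n + 4 - j"
      by (simp only: Suc_le_eq[symmetric] less_eq_div_iff_mult_less_eq zero_less_numeral)
    then show "5 * k + j < n" by simp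
    show "(5 * k + j) mod 5 = j" using assms by simp
  qed
  then show ?thesis by (simp add: card_image inj_on_def)
qed

text \<open>
  Writing \<open>m j = n/5 (1 + y j)\<close>, the linear terms \<open>y j\<close> cancel, and the quadratic ones are \<open>O(1/n\<^sup>2)\<close>.
\<close>

lemma balanced_product:
  fixes m :: "nat \<Rightarrow> real"
  assumes n: "n \<ge> 10" and sum: "(\<Sum>j<5. m j) = n" and m: "\<And>j. j < 5 \<Longrightarrow> \<bar>5 * m j - n\<bar> \<le> 5"
  shows "(n / 5) ^ 5 * exp (- (250 / n\<^sup>2)) \<le> (\<Prod>j<5. m j)"
proof -
  define y where "y = (\<lambda>j. 5 * m j / n - 1)"
  have y: "\<bar>y j\<bar> \<le> 5 / n" if "j < 5" for j
  proof -
    have "y j = (5 * m j - n) / n" using n by (simp add: y_def field_simps)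
    then show ?thesis using m[OF that] n by (simp add: abs_div divide_right_mono)
  qed
  have n5: "5 / n \<le> 1/2" using n by (simp add: field_simps)
  have my: "m j = n / 5 * (1 + y j)" for j using n by (simp add: y_def)
  have exp: "exp (y j - 50 / n\<^sup>2) \<le> 1 + y j" if "j < 5" for j
  proof -
    have "\<bar>ln (1 + y j) - y j\<bar> \<le> 2 * (y j)\<^sup>2"
      using y[OF that] n5 by (intro abs_ln_one_plus_x_minus_x_bound) simp
    moreover have "(y j)\<^sup>2 \<le> (5 / n)\<^sup>2" using power_mono[OF y[OF that], of 2] by simp
    ultimately have "y j - 50 / n\<^sup>2 \<le> ln (1 + y j)" by (simp add: power_divide)
    moreover have "0 < 1 + y j" using y[OF that] n5 by linarith
    ultimately show ?thesis by (simp add: ln_ge_iff)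
  qed
  have "(\<Sum>j<5. y j) = 0"
    using n by (simp add: y_def sum_subtractf flip: sum_divide_distrib sum_distrib_left) (simp add: sum)
  then have "exp (- (250 / n\<^sup>2)) = (\<Prod>j<(5::nat). exp (y j - 50 / n\<^sup>2))"
    by (simp add: exp_sum[symmetric] sum_subtractf)
  also have "\<dots> \<le> (\<Prod>j<5. 1 + y j)" by (intro prod_mono) (auto simp: exp)
  finally have "(n / 5) ^ 5 * exp (- (250 / n\<^sup>2)) \<le> (n / 5) ^ 5 * (\<Prod>j<5. 1 + y j)"
    using n by (intro mult_left_mono) auto
  also have "\<dots> = (\<Prod>j<5. m j)"
    unfolding my by (simp only: prod.distrib prod_constant card_lessThan)
  finally show ?thesis .
qed

text \<open>
  The ten closed walks of length five in \<open>C\<^sub>5\<close> start at one of five vertices in one of two directions.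
\<close>

lemma sum_consecutive_pentagons:
  fixes m :: "nat \<Rightarrow> real"
  shows "(\<Sum>a<5. m a * (\<Sum>b<5. m b * (\<Sum>c<5. m c * (\<Sum>d<5. m d * (\<Sum>e<5. m e *
      of_bool (pentagon consecutive a b c d e)))))) = 10 * (\<Prod>j<5. m j)"
proof -
  define M where "M = (\<lambda>f. \<Sum>b<5. m b * f b)"
  have M: "M (\<lambda>b. of_bool (consecutive 0 b) * f b) = m 1 * f 1 + m 4 * f 4"
    "M (\<lambda>b. of_bool (consecutive 1 b) * f b) = m 0 * f 0 + m 2 * f 2"
    "M (\<lambda>b. of_bool (consecutive 2 b) * f b) = m 1 * f 1 + m 3 * f 3"
    "M (\<lambda>b. of_bool (consecutive 3 b) * f b) = m 2 * f 2 + m 4 * f 4"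
    "M (\<lambda>b. of_bool (consecutive 4 b) * f b) = m 0 * f 0 + m 3 * f 3" for f
    by (simp_all add: M_def lessThan_5 consecutive_def)
  have M0: "M f = m 0 * f 0 + m 1 * f 1 + m 2 * f 2 + m 3 * f 3 + m 4 * f 4" for f
    by (simp add: M_def lessThan_5)
  have cmult: "M (\<lambda>b. c * f b) = c * M f" for c f
    by (simp add: M_def sum_distrib_left mult.left_commute)
  have "M (\<lambda>a. M (\<lambda>b. M (\<lambda>c. M (\<lambda>d. M (\<lambda>e. of_bool (pentagon consecutive a b c d e))))))
    = M (\<lambda>a. M (\<lambda>b. of_bool (consecutive a b) * M (\<lambda>c. of_bool (consecutive b c) *
        M (\<lambda>d. of_bool (consecutive c d) * M (\<lambda>e. of_bool (consecutive d e) * of_bool (consecutive e a))))))"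
    by (simp only: pentagon_def of_bool_conj cmult)
  also have "\<dots> = 10 * (m 0 * m 1 * m 2 * m 3 * m 4)"
    by (subst M0, simp only: M) (simp add: consecutive_def algebra_simps)
  also have "m 0 * m 1 * m 2 * m 3 * m 4 = (\<Prod>j<5. m j)" by (simp add: lessThan_5 mult.assoc)
  finally show ?thesis by (simp only: M_def)
qed

text \<open>
  The constant vector already gives this value.
\<close>

lemma C5_blowup_spectral_radius:
  fixes n :: nat
  assumes n: "n \<ge> 10" and \<alpha>: "\<alpha> > 1"
  shows "2/625 * (n powr (1 - 1/\<alpha>)) ^ 5 * exp (- (250 / n\<^sup>2)) \<le> spectral_radius \<alpha> C5 (C5_blowup n)"
proof -
  define y where "y = n powr (- 1/\<alpha>)"
  define x where "x = restrict (\<lambda>_. y) {..<n}"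
  define cnt where "cnt = (\<lambda>j. real (card {u. u < n \<and> u mod 5 = j}))"
  have y: "y \<ge> 0" by (simp add: y_def)
  have V: "pverts (C5_blowup n) = {..<n}" by (simp add: C5_blowup_def)
  have "(\<Sum>v<n. \<bar>x v\<bar> powr \<alpha>) = (\<Sum>v<n. y powr \<alpha>)"
    by (intro sum.cong) (auto simp: x_def y)
  also have "\<dots> = n * n powr (- 1)" using \<alpha> by (simp only: y_def powr_powr) simp
  also have "\<dots> = 1" using n by (simp add: powr_minus)
  finally have "x \<in> alpha_sphere (pverts (C5_blowup n)) \<alpha>"
    by (simp add: alpha_sphere_def V x_def)
  then have le: "hom_poly C5 (C5_blowup n) x \<le> spectral_radius \<alpha> C5 (C5_blowup n)"
    using n \<alpha> by (intro spectral_radius_is_max) (auto simp: V lessThan_empty_iff)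
  have x0: "0 \<le> x v" if "v \<in> pverts (C5_blowup n)" for v using that y by (simp add: x_def V)
  interpret W: weighted_triangle_free "pverts (C5_blowup n)" x "adjacent (C5_blowup n)"
    by (rule weighted_triangle_free_graph[OF pair_graph_C5_blowup K3_free_C5_blowup x0])
  have residues: "(\<Sum>u<n. f (u mod 5)) = (\<Sum>j<5. cnt j * f j)" for f :: "nat \<Rightarrow> real"
  proof -
    have "(\<Sum>u<n. f (u mod 5)) = (\<Sum>j<5. \<Sum>u\<in>{u \<in> {..<n}. u mod 5 = j}. f (u mod 5))"
      by (rule sum.group[symmetric]) auto
    also have "\<dots> = (\<Sum>j<5. cnt j * f j)"
      by (intro sum.cong refl) (simp add: cnt_def)
    finally show ?thesis .
  qed
  define M where "M = (\<lambda>f. \<Sum>j<5. (y * cnt j) * f j)"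
  have avg: "W.avg (\<lambda>u. f (u mod 5)) = M f" for f
  proof -
    have "W.avg (\<lambda>u. f (u mod 5)) = (\<Sum>u<n. y * f (u mod 5))"
      unfolding W.avg_def by (simp add: V x_def)
    also have "\<dots> = y * (\<Sum>u<n. f (u mod 5))" by (simp only: sum_distrib_left)
    also have "\<dots> = M f" unfolding residues M_def by (simp only: sum_distrib_left mult.assoc)
    finally show ?thesis .
  qed
  have "W.C5_density = W.avg (\<lambda>a. W.avg (\<lambda>b. W.avg (\<lambda>c. W.avg (\<lambda>d. W.avg (\<lambda>e.
      of_bool (pentagon consecutive (a mod 5) (b mod 5) (c mod 5) (d mod 5) (e mod 5)))))))"
    unfolding W.C5_density_def
    by (intro W.avg_cong) (auto simp: C5_blowup_def pentagon_def)
  also have "\<dots> = M (\<lambda>a. M (\<lambda>b. M (\<lambda>c. M (\<lambda>d. M (\<lambda>e. of_bool (pentagon consecutive a b c d e))))))"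
    by (subst avg, subst avg, subst avg, subst avg, subst avg) (rule refl)
  also have "\<dots> = 10 * (\<Prod>j<5. y * cnt j)"
    unfolding M_def by (rule sum_consecutive_pentagons)
  also have "\<dots> = 10 * (y ^ 5 * (\<Prod>j<5. cnt j))" by (simp add: prod.distrib)
  finally have density: "W.C5_density = 10 * (y ^ 5 * (\<Prod>j<5. cnt j))" .
  have "(n powr (1 - 1/\<alpha>)) = y * n"
  proof -
    have "real n powr (1 - 1/\<alpha>) = real n powr (- 1/\<alpha> + 1)" by (simp add: algebra_simps)
    also have "\<dots> = y * n" using n unfolding powr_add y_def by simp
    finally show ?thesis .
  qed
  then have "2/625 * (n powr (1 - 1/\<alpha>)) ^ 5 * exp (- (250 / (real n)\<^sup>2))
      = 10 * (y ^ 5 * ((n / 5) ^ 5 * exp (- (250 / (real n)\<^sup>2))))"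
    by (simp add: power_mult_distrib power_divide)
  also have "\<dots> \<le> W.C5_density"
    unfolding density
  proof (intro mult_left_mono balanced_product)
    show "(\<Sum>j<5. cnt j) = real n" using residues[of "\<lambda>_. 1"] by simp
    show "\<bar>5 * cnt j - real n\<bar> \<le> 5" if "j < 5" for j
    proof -
      have "5 * ((n + 4 - j) div 5) \<le> n + 5" "n \<le> 5 * ((n + 4 - j) div 5) + 5" using that by presburger+
      then have "real (5 * ((n + 4 - j) div 5)) \<le> real (n + 5)" "real n \<le> real (5 * ((n + 4 - j) div 5) + 5)"
        by (simp_all only: of_nat_le_iff)
      then show ?thesis unfolding cnt_def residue_class_card[OF that] by simp
    qed
  qed (use n y in auto)
  also have "W.C5_density = hom_poly C5 (C5_blowup n) x"
    using hom_poly_C5[where x = x, OF pair_graph_C5_blowup K3_free_C5_blowup x0] by simp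
  finally show ?thesis using le by simp
qed

text \<open>
  All coefficients of the polynomial are nonnegative, so passing to absolute values does not decrease it.
\<close>

lemma nonneg_maximizer:
  assumes G: "pair_graph G" "K3_free G" and V: "pverts G \<noteq> {}" and \<alpha>: "\<alpha> > 0"
  obtains w where "\<And>v. v \<in> pverts G \<Longrightarrow> 0 \<le> w v" "(\<Sum>v\<in>pverts G. w v powr \<alpha>) = 1"
    "weighted_triangle_free.C5_density (pverts G) w (adjacent G) = spectral_radius \<alpha> C5 G"
proof -
  interpret pair_graph G by fact
  note max = spectral_radius_is_max[where G = G and \<alpha> = \<alpha> and F = C5, OF pair_finite_verts V \<alpha>]
  obtain x where x: "x \<in> alpha_sphere (pverts G) \<alpha>" "spectral_radius \<alpha> C5 G = hom_poly C5 G x"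
    using max(1) by blast
  define w where "w = restrict (\<lambda>v. \<bar>x v\<bar>) (pverts G)"
  have w: "w \<in> alpha_sphere (pverts G) \<alpha>" using x(1) by (simp add: alpha_sphere_def w_def)
  have w0: "0 \<le> w v" if "v \<in> pverts G" for v using that by (simp add: w_def)
  have "hom_poly C5 G x \<le> hom_poly C5 G w"
    unfolding hom_poly_def
  proof (rule sum_mono)
    fix \<phi> assume "\<phi> \<in> inj_homs C5 G"
    then have "\<phi> ` pverts C5 \<subseteq> pverts G" by (auto simp: inj_homs_def graph_homs_def PiE_iff)
    then have "(\<Prod>i\<in>\<phi> ` pverts C5. w i) = \<bar>\<Prod>i\<in>\<phi> ` pverts C5. x i\<bar>"
      unfolding abs_prod by (intro prod.cong) (auto simp: w_def)
    then show "(\<Prod>i\<in>\<phi> ` pverts C5. x i) \<le> (\<Prod>i\<in>\<phi> ` pverts C5. w i)" by simp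
  qed
  with max(2)[OF w] x(2) have "hom_poly C5 G w = spectral_radius \<alpha> C5 G" by simp
  moreover have "(\<Sum>v\<in>pverts G. w v powr \<alpha>) = 1"
    using w w0 by (simp add: alpha_sphere_def)
  ultimately show ?thesis
    using hom_poly_C5[where x = w, OF G w0] by (intro that[OF w0]) simp_all
qed

lemma hom_poly_le_spectral_radius:
  assumes G: "pair_graph G" "K3_free G" and V: "pverts G \<noteq> {}" and \<alpha>: "\<alpha> > 0"
    and x: "\<And>v. v \<in> pverts G \<Longrightarrow> 0 \<le> x v"
  shows "weighted_triangle_free.C5_density (pverts G) x (adjacent G)
    \<le> spectral_radius \<alpha> C5 G * (\<Sum>v\<in>pverts G. x v powr \<alpha>) powr (5/\<alpha>)"
proof -
  interpret pair_graph G by fact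
  interpret W: weighted_triangle_free "pverts G" x "adjacent G"
    by (rule weighted_triangle_free_graph) fact+
  define S where "S = (\<Sum>v\<in>pverts G. x v powr \<alpha>)"
  have "S \<ge> 0" by (simp add: S_def sum_nonneg)
  show ?thesis
  proof (cases "S = 0")
    case True
    then have "x v = 0" if "v \<in> pverts G" for v
      using that by (simp add: S_def sum_nonneg_eq_0_iff)
    then have "W.avg f = 0" for f by (simp add: W.avg_def)
    then show ?thesis using True unfolding S_def by (simp add: W.C5_density_def)
  next
    case False
    with \<open>S \<ge> 0\<close> have S: "S > 0" by simp
    define s where "s = S powr (- 1/\<alpha>)"
    have s: "s > 0" using S by (simp add: s_def)
    interpret Y: weighted_triangle_free "pverts G" "\<lambda>v. s * x v" "adjacent G"
      using s x by (intro W.weighted_triangle_free_weights) simp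
    define z where "z = restrict (\<lambda>v. s * x v) (pverts G)"
    have z0: "0 \<le> z v" if "v \<in> pverts G" for v using that s x by (simp add: z_def)
    have "(\<Sum>v\<in>pverts G. \<bar>z v\<bar> powr \<alpha>) = (\<Sum>v\<in>pverts G. s powr \<alpha> * x v powr \<alpha>)"
      using s x by (intro sum.cong) (auto simp: z_def powr_mult)
    also have "\<dots> = s powr \<alpha> * S" by (simp add: S_def sum_distrib_left)
    also have "\<dots> = S powr (- 1) * S" using \<alpha> by (simp only: s_def powr_powr) simp
    also have "\<dots> = 1" using S by (simp add: powr_minus)
    finally have "z \<in> alpha_sphere (pverts G) \<alpha>" by (simp add: alpha_sphere_def z_def)
    then have "hom_poly C5 G z \<le> spectral_radius \<alpha> C5 G"
      by (intro spectral_radius_is_max pair_finite_verts V \<alpha>)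
    moreover have "hom_poly C5 G z = Y.C5_density"
      using hom_poly_C5[where x = z, OF G z0] Y.C5_density_cong[of z] by (simp add: z_def)
    moreover have "Y.C5_density = s ^ 5 * W.C5_density"
      by (rule W.scaled_densities) (use s in simp)
    ultimately have le: "s ^ 5 * W.C5_density \<le> spectral_radius \<alpha> C5 G" by simp
    have "s ^ 5 * S powr (5/\<alpha>) = 1"
    proof -
      have "s ^ 5 = s powr 5" using s by (simp add: powr_numeral)
      also have "\<dots> = S powr (- (5/\<alpha>))" by (simp add: s_def powr_powr)
      finally show ?thesis using S by (simp add: powr_minus)
    qed
    then have "W.C5_density = W.C5_density * (s ^ 5 * S powr (5/\<alpha>))" by simp
    also have "\<dots> = s ^ 5 * W.C5_density * S powr (5/\<alpha>)" by (simp only: mult_ac)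
    also have "\<dots> \<le> spectral_radius \<alpha> C5 G * S powr (5/\<alpha>)" using le by (rule mult_right_mono) simp
    finally show ?thesis by (simp only: S_def)
  qed
qed

theorem theorem1p2:
  fixes \<alpha> :: real
  assumes "\<alpha> > 1"
  shows "\<exists>N0 :: nat. \<forall>n \<ge> N0. \<forall>G :: nat pair_pre_digraph.
    pair_graph G \<longrightarrow> card (pverts G) = n \<longrightarrow> K3_free G \<longrightarrow>
      spectral_radius \<alpha> C5 G
        \<le> Max {spectral_radius \<alpha> C5 H | H :: nat pair_pre_digraph.
                 H \<in> C5_colorable_graphs \<and> card (pverts H) = n} \<and>
      (spectral_radius \<alpha> C5 G
         = Max {spectral_radius \<alpha> C5 H | H :: nat pair_pre_digraph.
                 H \<in> C5_colorable_graphs \<and> card (pverts H) = n}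
       \<longrightarrow> G \<in> C5_colorable_graphs)"
proof -
  define \<beta> where "\<beta> = 1 - 1/\<alpha>"
  have \<beta>: "\<beta> > 0" using assms by (simp add: \<beta>_def)
  have "(\<lambda>n::nat. exp (- (250 * (1 / real n)\<^sup>2)) * (1 - 60 / \<beta> * (1 / real n)))
      \<longlonglongrightarrow> exp (- (250 * 0\<^sup>2)) * (1 - 60 / \<beta> * 0)"
    by (intro tendsto_intros lim_1_over_n)
  then have "(\<lambda>n::nat. exp (- (250 / (real n)\<^sup>2)) * (1 - 60 / (\<beta> * real n))) \<longlonglongrightarrow> 1"
    by (simp add: power_divide)
  then have "\<forall>\<^sub>F n::nat in sequentially. 1 - 1/10^15 < exp (- (250 / (real n)\<^sup>2)) * (1 - 60 / (\<beta> * real n))"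
    by (rule order_tendstoD) simp
  then obtain N1 :: nat where N1: "\<And>n. n \<ge> N1 \<Longrightarrow>
      1 - 1/10^15 < exp (- (250 / (real n)\<^sup>2)) * (1 - 60 / (\<beta> * real n))"
    unfolding eventually_sequentially by blast
  show ?thesis
  proof (intro exI[of _ "max N1 10"] allI impI)
    fix n and G :: "nat pair_pre_digraph"
    assume "max N1 10 \<le> n" and G: "pair_graph G" "card (pverts G) = n" "K3_free G"
    then have n: "n \<ge> N1" "n \<ge> 10" by auto
    define S where "S = {spectral_radius \<alpha> C5 H | H :: nat pair_pre_digraph.
                 H \<in> C5_colorable_graphs \<and> card (pverts H) = n}"
    have fin: "finite S" unfolding S_def using n by (intro finite_spectral_radii pair_graph_C5) simp
    (* Both claims follow from this: a graph that reaches the maximum is itself one of the competitors. *)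
    have colorable: "G \<in> C5_colorable_graphs" if ge: "Max S \<le> spectral_radius \<alpha> C5 G"
    proof -
      interpret pair_graph G by fact
      have V: "pverts G \<noteq> {}" using G(2) n(2) by auto
      obtain w where w: "\<And>v. v \<in> pverts G \<Longrightarrow> 0 \<le> w v" "(\<Sum>v\<in>pverts G. w v powr \<alpha>) = 1"
        "weighted_triangle_free.C5_density (pverts G) w (adjacent G) = spectral_radius \<alpha> C5 G"
        using nonneg_maximizer[OF G(1,3) V, of \<alpha>] assms by auto
      interpret weighted_triangle_free "pverts G" w "adjacent G"
        by (rule weighted_triangle_free_graph[OF G(1,3) w(1)])
      interpret optimal_weights "pverts G" w "adjacent G" \<alpha>
      proof
        fix x :: "nat \<Rightarrow> real" assume "\<And>v. v \<in> pverts G \<Longrightarrow> 0 \<le> x v"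
        then show "weighted_triangle_free.C5_density (pverts G) x (adjacent G)
            \<le> C5_density * (\<Sum>v\<in>pverts G. x v powr \<alpha>) powr (5 / \<alpha>)"
          unfolding w(3) using assms by (intro hom_poly_le_spectral_radius G V) auto
      next
        have "spectral_radius \<alpha> C5 (C5_blowup n) \<in> S"
          unfolding S_def using C5_blowup_colorable[of n] by (force simp: C5_blowup_def)
        then have "spectral_radius \<alpha> C5 (C5_blowup n) \<le> C5_density"
          using Max_ge[OF fin] ge w(3) by force
        then show "2/625 * (card (pverts G) powr (1 - 1/\<alpha>)) ^ 5 * exp (- (250 / (card (pverts G))\<^sup>2)) \<le> C5_density"
          using C5_blowup_spectral_radius[OF n(2) assms] unfolding G(2) by simp
      qed (use assms w(2) G(2) n(2) in auto)
      obtain col where "\<forall>v\<in>pverts G. col v < (5::nat)"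
        "\<forall>u\<in>pverts G. \<forall>v\<in>pverts G. (u, v) \<in> parcs G \<longrightarrow> consecutive (col u) (col v)"
        using C5_coloring_optimal N1[OF n(1)] unfolding G(2) \<beta>_def by auto
      then show ?thesis
        using in_arcsD1 in_arcsD2 by (intro C5_colorable_graphs_coloring[OF G(1), of col]) auto
    qed
    show "spectral_radius \<alpha> C5 G \<le> Max {spectral_radius \<alpha> C5 H | H :: nat pair_pre_digraph.
                 H \<in> C5_colorable_graphs \<and> card (pverts H) = n} \<and>
      (spectral_radius \<alpha> C5 G = Max {spectral_radius \<alpha> C5 H | H :: nat pair_pre_digraph.
                 H \<in> C5_colorable_graphs \<and> card (pverts H) = n}
       \<longrightarrow> G \<in> C5_colorable_graphs)"
      unfolding S_def[symmetric]
    proof (intro conjI impI)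
      show "spectral_radius \<alpha> C5 G \<le> Max S"
      proof (rule ccontr)
        assume greater: "\<not> spectral_radius \<alpha> C5 G \<le> Max S"
        then have "G \<in> C5_colorable_graphs" using colorable by simp
        then have "spectral_radius \<alpha> C5 G \<in> S" using G(2) by (auto simp: S_def)
        then show False using greater Max_ge[OF fin] by blast
      qed
    qed (use colorable in simp)
  qed
qed

end
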